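(* Let $m$ be a square-free positive integer. The subgroup $\Delta_m$ of the Bianchi group $\mathrm{PSL}(2,\mathcal{O}_m)$ retracts onto the free group on $2$ generators.
   Context: $\mathcal{O}_m$ is the ring of integers of $\mathbb{Q}(\sqrt{-m})$: $\mathcal{O}_m=\mathbb{Z}[\sqrt{-m}]$ if $m\equiv 1,2\pmod 4$ and $\mathcal{O}_m=\mathbb{Z}[\frac{1+\sqrt{-m}}{2}]$ if $m\equiv 3\pmod 4$. $\mathrm{PSL}(2,\mathcal{O}_m)_{(2)}$ denotes the principal congruence subgroup of level $2$, i.e. the image in $\mathrm{PSL}(2,\mathcal{O}_m)$ of the matrices in $\mathrm{SL}(2,\mathcal{O}_m)$ congruent to $I$ modulo $2\mathcal{O}_m$. The subgroup $\Delta_m$ is defined as follows. If $m\equiv 1,2\pmod 4$, then $\Delta_m=\mathrm{PSL}(2,\mathcal{O}_m)_{(2)}$. If $m\equiv 3 \pmod 4$, then, with $\omega=\frac{1+\sqrt{-m}}{2}$, $\Delta_m$ is the index $2$ subgroup of $\mathrm{PSL}(2,\mathcal{O}_m)_{(2)}$ consisting of the elements $$\begin{pmatrix}2a_0+1+2a_1\omega & 2b_0+2b_1\omega\\ 2c_0+2c_1\omega & 2d_0+1+2d_1\omega\end{pmatrix}\quad (a_i,b_i,c_i,d_i\in\mathbb{Z})$$ with $b_1\equiv c_1 \pmod 2$. A group $G$ retracts onto a group $H$ if $H$ is (isomorphic to) a subgroup of $G$ and there is a homomorphism $G\to H$ restricting to the identity on $H$. *)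

theory Defs
  imports
    "HOL-Algebra.Coset"
    "HOL-Algebra.Generated_Groups"
    "HOL-Analysis.Analysis"
    "HOL-Computational_Algebra.Squarefree"
    "HOL-Number_Theory.Cong"
begin

section \<open>The ring of integers of an imaginary quadratic field\<close>

definition sqrt_neg :: "nat \<Rightarrow> complex" where
  "sqrt_neg m = \<i> * complex_of_real (sqrt (real m))"

definition quad_omega :: "nat \<Rightarrow> complex" where
  "quad_omega m = (if m mod 4 = 3 then (1 + sqrt_neg m) / 2 else sqrt_neg m)"

text \<open>
  The \<open>\<int>\<close>-span of \<open>1\<close> and \<open>quad_omega m\<close> is the ring \<open>\<int>[quad_omega m]\<close>, because
  \<open>quad_omega m\<close> satisfies a monic quadratic equation over \<open>\<int>\<close> (\<open>quad_omega_sq\<close>). For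
  squarefree \<open>m\<close> this is the ring of integers of the field \<open>\<rat>(sqrt_neg m)\<close>.
\<close>

definition bianchi_ring :: "nat \<Rightarrow> complex set" where
  "bianchi_ring m = {of_int a + of_int b * quad_omega m | a b. True}"

lemma sqrt_neg_sq: "sqrt_neg m * sqrt_neg m = - of_nat m"
proof -
  have "sqrt_neg m * sqrt_neg m = - complex_of_real (sqrt (real m) * sqrt (real m))"
    unfolding sqrt_neg_def by (simp add: algebra_simps flip: of_real_mult)
  thus ?thesis by simp
qed

lemma quad_omega_sq: "\<exists>p q. quad_omega m * quad_omega m = of_int p + of_int q * quad_omega m"
proof (cases "m mod 4 = 3")
  case True
  then obtain k where k: "m = 4 * k + 3"
    by (metis mult_div_mod_eq)
  define s where "s = sqrt_neg m"
  have s2: "s * s = - of_nat (4 * k + 3)"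
    using sqrt_neg_sq[of m] k by (simp add: s_def)
  have w: "quad_omega m = (1 + s) / 2" using True by (simp add: quad_omega_def s_def)
  have "quad_omega m * quad_omega m = (1 + 2 * s + s * s) / 4"
    unfolding w by (simp add: field_simps)
  also have "\<dots> = of_int (- int k - 1) + of_int 1 * quad_omega m"
    unfolding s2 w by (simp add: field_simps)
  finally have "quad_omega m * quad_omega m = of_int (- int k - 1) + of_int 1 * quad_omega m" .
  thus ?thesis by blast
next
  case False
  hence "quad_omega m * quad_omega m = of_int (- int m) + of_int 0 * quad_omega m"
    using sqrt_neg_sq[of m] unfolding quad_omega_def by simp
  thus ?thesis by blast
qed

lemma bianchi_ringI: "x = of_int a + of_int b * quad_omega m \<Longrightarrow> x \<in> bianchi_ring m"
  unfolding bianchi_ring_def by blast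

lemma bianchi_ring_add: "x \<in> bianchi_ring m \<Longrightarrow> y \<in> bianchi_ring m \<Longrightarrow> x + y \<in> bianchi_ring m"
proof -
  assume "x \<in> bianchi_ring m" "y \<in> bianchi_ring m"
  then obtain a b c d where "x = of_int a + of_int b * quad_omega m"
    "y = of_int c + of_int d * quad_omega m" unfolding bianchi_ring_def by blast
  thus ?thesis by (intro bianchi_ringI[of _ "a + c" "b + d"]) (simp add: algebra_simps)
qed

lemma bianchi_ring_uminus: "x \<in> bianchi_ring m \<Longrightarrow> - x \<in> bianchi_ring m"
proof -
  assume "x \<in> bianchi_ring m"
  then obtain a b where "x = of_int a + of_int b * quad_omega m"
    unfolding bianchi_ring_def by blast
  thus ?thesis by (intro bianchi_ringI[of _ "- a" "- b"]) (simp add: algebra_simps)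
qed

lemma bianchi_ring_mult: "x \<in> bianchi_ring m \<Longrightarrow> y \<in> bianchi_ring m \<Longrightarrow> x * y \<in> bianchi_ring m"
proof -
  assume "x \<in> bianchi_ring m" "y \<in> bianchi_ring m"
  then obtain a b c d where xy: "x = of_int a + of_int b * quad_omega m"
    "y = of_int c + of_int d * quad_omega m" unfolding bianchi_ring_def by blast
  obtain p q where pq: "quad_omega m * quad_omega m = of_int p + of_int q * quad_omega m"
    using quad_omega_sq by blast
  have "x * y = of_int (a * c) + of_int (a * d + b * c) * quad_omega m
          + of_int (b * d) * (quad_omega m * quad_omega m)"
    unfolding xy by (simp add: algebra_simps)
  also have "\<dots> = of_int (a * c + b * d * p) + of_int (a * d + b * c + b * d * q) * quad_omega m"
    unfolding pq by (simp add: algebra_simps)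
  finally show ?thesis by (rule bianchi_ringI)
qed

lemma bianchi_ring_0: "0 \<in> bianchi_ring m" and bianchi_ring_1: "1 \<in> bianchi_ring m"
  by (rule bianchi_ringI[of _ 0 0], simp) (rule bianchi_ringI[of _ 1 0], simp)

lemmas bianchi_ring_closed =
  bianchi_ring_add bianchi_ring_uminus bianchi_ring_mult bianchi_ring_0 bianchi_ring_1


section \<open>Bianchi groups and their congruence subgroups\<close>

definition SL2 :: "complex set \<Rightarrow> (complex^2^2) monoid" where
  "SL2 R = \<lparr>carrier = {A. (\<forall>i j. A $ i $ j \<in> R) \<and> det A = 1}, monoid.mult = (**), one = mat 1\<rparr>"

definition PSL2 :: "complex set \<Rightarrow> (complex^2^2) set monoid" where
  "PSL2 R = SL2 R Mod {mat 1, - mat 1}"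

definition PSL2_image :: "complex set \<Rightarrow> (complex^2^2) set \<Rightarrow> (complex^2^2) set set" where
  "PSL2_image R M = (\<lambda>A. {mat 1, - mat 1} #>\<^bsub>SL2 R\<^esub> A) ` M"

definition SL2_principal_congruence :: "complex set \<Rightarrow> nat \<Rightarrow> (complex^2^2) set" where
  "SL2_principal_congruence R n =
    {A \<in> carrier (SL2 R). \<forall>i j. \<exists>x\<in>R. A $ i $ j - (mat 1 :: complex^2^2) $ i $ j = of_nat n * x}"

definition level2_matrix ::
    "nat \<Rightarrow> int \<Rightarrow> int \<Rightarrow> int \<Rightarrow> int \<Rightarrow> int \<Rightarrow> int \<Rightarrow> int \<Rightarrow> int \<Rightarrow> complex^2^2" where
  "level2_matrix m a0 a1 b0 b1 c0 c1 d0 d1 = (let \<omega> = quad_omega m in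
     vector [vector [2 * of_int a0 + 1 + 2 * of_int a1 * \<omega>, 2 * of_int b0 + 2 * of_int b1 * \<omega>],
             vector [2 * of_int c0 + 2 * of_int c1 * \<omega>, 2 * of_int d0 + 1 + 2 * of_int d1 * \<omega>]])"

text \<open>
  In the case \<open>m mod 4 = 3\<close> the coefficients in \<open>level2_matrix\<close> are determined by the matrix,
  and the parity condition is invariant under negation, so that it is a condition on the image
  in \<open>PSL2\<close>.
\<close>

definition Delta_matrices :: "nat \<Rightarrow> (complex^2^2) set" where
  "Delta_matrices m =
    (if m mod 4 = 3 then
       {A \<in> carrier (SL2 (bianchi_ring m)). \<exists>a0 a1 b0 b1 c0 c1 d0 d1.
          A = level2_matrix m a0 a1 b0 b1 c0 c1 d0 d1 \<and> [b1 = c1] (mod 2)}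
     else SL2_principal_congruence (bianchi_ring m) 2)"

definition Delta :: "nat \<Rightarrow> (complex^2^2) set monoid" where
  "Delta m =
    (PSL2 (bianchi_ring m))\<lparr>carrier := PSL2_image (bianchi_ring m) (Delta_matrices m)\<rparr>"

lemma mat2_mult:
  fixes A B :: "complex^2^2"
  shows "(A ** B) $ i $ j = A $ i $ 1 * B $ 1 $ j + A $ i $ 2 * B $ 2 $ j"
  by (simp add: matrix_matrix_mult_def sum_2)

lemma mat2_eqI:
  fixes A B :: "complex^2^2"
  assumes "A $ 1 $ 1 = B $ 1 $ 1" "A $ 1 $ 2 = B $ 1 $ 2" "A $ 2 $ 1 = B $ 2 $ 1" "A $ 2 $ 2 = B $ 2 $ 2"
  shows "A = B"
  using assms by (simp add: vec_eq_iff forall_2)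

lemma mat1_2 [simp]:
  "(mat 1 :: complex^2^2) $ 1 $ 1 = 1" "(mat 1 :: complex^2^2) $ 1 $ 2 = 0"
  "(mat 1 :: complex^2^2) $ 2 $ 1 = 0" "(mat 1 :: complex^2^2) $ 2 $ 2 = 1"
  by (simp_all add: mat_def)

definition adj2 :: "complex^2^2 \<Rightarrow> complex^2^2" where
  "adj2 A = vector [vector [A $ 2 $ 2, - A $ 1 $ 2], vector [- A $ 2 $ 1, A $ 1 $ 1]]"

lemma adj2_nth [simp]:
  "adj2 A $ 1 $ 1 = A $ 2 $ 2" "adj2 A $ 1 $ 2 = - A $ 1 $ 2"
  "adj2 A $ 2 $ 1 = - A $ 2 $ 1" "adj2 A $ 2 $ 2 = A $ 1 $ 1"
  by (simp_all add: adj2_def)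

lemma SL2_simps [simp]: "monoid.mult (SL2 R) = (**)" "one (SL2 R) = mat 1"
  by (simp_all add: SL2_def)

lemma SL2_carrier_iff:
  "A \<in> carrier (SL2 R) \<longleftrightarrow>
    A $ 1 $ 1 \<in> R \<and> A $ 1 $ 2 \<in> R \<and> A $ 2 $ 1 \<in> R \<and> A $ 2 $ 2 \<in> R
    \<and> A $ 1 $ 1 * A $ 2 $ 2 - A $ 1 $ 2 * A $ 2 $ 1 = 1"
  by (simp add: SL2_def forall_2 det_2)

lemma adj2_inverse:
  assumes "A \<in> carrier (SL2 R)"
  shows "adj2 A ** A = mat 1"
  using assms by (intro mat2_eqI) (simp_all add: SL2_carrier_iff mat2_mult algebra_simps)

lemma adj2_closed:
  assumes "A \<in> carrier (SL2 (bianchi_ring m))"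
  shows "adj2 A \<in> carrier (SL2 (bianchi_ring m))"
  using assms by (simp add: SL2_carrier_iff bianchi_ring_uminus mult.commute)

lemma SL2_mult_closed:
  assumes "A \<in> carrier (SL2 (bianchi_ring m))" "B \<in> carrier (SL2 (bianchi_ring m))"
  shows "A ** B \<in> carrier (SL2 (bianchi_ring m))"
proof -
  have "det (A ** B) = 1"
    using assms by (simp add: SL2_def det_mul)
  moreover have "(A ** B) $ i $ j \<in> bianchi_ring m" for i j
    unfolding mat2_mult
    by (intro bianchi_ring_add bianchi_ring_mult) (use assms in \<open>simp_all add: SL2_def\<close>)
  ultimately show ?thesis by (simp add: SL2_def)
qed

lemma SL2_one_closed: "mat 1 \<in> carrier (SL2 (bianchi_ring m))"
  by (simp add: SL2_carrier_iff bianchi_ring_closed)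

lemma group_SL2_bianchi: "group (SL2 (bianchi_ring m))"
proof (rule groupI)
  fix A assume A: "A \<in> carrier (SL2 (bianchi_ring m))"
  show "\<exists>B\<in>carrier (SL2 (bianchi_ring m)). B \<otimes>\<^bsub>SL2 (bianchi_ring m)\<^esub> A = \<one>\<^bsub>SL2 (bianchi_ring m)\<^esub>"
    using adj2_closed[OF A] adj2_inverse[OF A] by auto
qed (simp_all add: SL2_mult_closed SL2_one_closed matrix_mul_assoc)

lemma inv_SL2_bianchi:
  assumes "A \<in> carrier (SL2 (bianchi_ring m))"
  shows "inv\<^bsub>SL2 (bianchi_ring m)\<^esub> A = adj2 A"
proof -
  interpret group "SL2 (bianchi_ring m)" by (rule group_SL2_bianchi)
  show ?thesis
    using assms adj2_closed[OF assms] adj2_inverse[OF assms] by (intro inv_equality) simp_all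
qed

lemma neg_mat1_mult:
  fixes A :: "complex^2^2"
  shows "- mat 1 ** A = - A" "A ** - mat 1 = - A"
  by (rule mat2_eqI; simp add: mat2_mult)+

lemma centre_normal: "{mat 1, - mat 1} \<lhd> SL2 (bianchi_ring m)"
proof -
  interpret group "SL2 (bianchi_ring m)" by (rule group_SL2_bianchi)
  let ?Z = "{mat 1, - mat 1 :: complex^2^2}"
  have Z: "?Z \<subseteq> carrier (SL2 (bianchi_ring m))"
    by (simp add: SL2_carrier_iff bianchi_ring_closed)
  have "subgroup ?Z (SL2 (bianchi_ring m))"
  proof (rule subgroupI)
    fix A assume A: "A \<in> ?Z"
    have "adj2 (mat 1) = mat 1" "adj2 (- mat 1) = - mat 1"
      by (rule mat2_eqI; simp)+
    hence "adj2 A \<in> ?Z" using A by auto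
    moreover have "A \<in> carrier (SL2 (bianchi_ring m))" using A Z by blast
    ultimately show "inv\<^bsub>SL2 (bianchi_ring m)\<^esub> A \<in> ?Z" by (simp only: inv_SL2_bianchi)
  qed (use Z in \<open>auto simp: neg_mat1_mult\<close>)
  thus ?thesis
  proof (rule normalI, intro ballI)
    fix A
    show "?Z #>\<^bsub>SL2 (bianchi_ring m)\<^esub> A = A <#\<^bsub>SL2 (bianchi_ring m)\<^esub> ?Z"
      by (simp add: r_coset_def l_coset_def neg_mat1_mult)
  qed
qed

lemma group_PSL2_bianchi: "group (PSL2 (bianchi_ring m))"
  unfolding PSL2_def by (rule normal.factorgroup_is_group[OF centre_normal])

lemma level2_matrix_nth [simp]:
  "level2_matrix m a0 a1 b0 b1 c0 c1 d0 d1 $ 1 $ 1 = 1 + 2 * (of_int a0 + of_int a1 * quad_omega m)"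
  "level2_matrix m a0 a1 b0 b1 c0 c1 d0 d1 $ 1 $ 2 = 2 * (of_int b0 + of_int b1 * quad_omega m)"
  "level2_matrix m a0 a1 b0 b1 c0 c1 d0 d1 $ 2 $ 1 = 2 * (of_int c0 + of_int c1 * quad_omega m)"
  "level2_matrix m a0 a1 b0 b1 c0 c1 d0 d1 $ 2 $ 2 = 1 + 2 * (of_int d0 + of_int d1 * quad_omega m)"
  by (simp_all add: level2_matrix_def Let_def distrib_left)

lemma principal_congruence_2_iff:
  "A \<in> SL2_principal_congruence (bianchi_ring m) 2 \<longleftrightarrow>
    A \<in> carrier (SL2 (bianchi_ring m)) \<and>
    (\<exists>a0 a1 b0 b1 c0 c1 d0 d1. A = level2_matrix m a0 a1 b0 b1 c0 c1 d0 d1)"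
proof
  assume A: "A \<in> SL2_principal_congruence (bianchi_ring m) 2"
  have E: "\<exists>p q. A $ i $ j = (mat 1 :: complex^2^2) $ i $ j
              + 2 * (of_int p + of_int q * quad_omega m)" for i j
  proof -
    have "\<exists>x\<in>bianchi_ring m. A $ i $ j - (mat 1 :: complex^2^2) $ i $ j = 2 * x"
      using A by (simp add: SL2_principal_congruence_def)
    then obtain p q where
      "A $ i $ j - (mat 1 :: complex^2^2) $ i $ j = 2 * (of_int p + of_int q * quad_omega m)"
      unfolding bianchi_ring_def by blast
    thus ?thesis by (metis add.commute diff_add_cancel)
  qed
  obtain a0 a1 where a: "A $ 1 $ 1 = 1 + 2 * (of_int a0 + of_int a1 * quad_omega m)"
    using E[of 1 1] by auto
  obtain b0 b1 where b: "A $ 1 $ 2 = 2 * (of_int b0 + of_int b1 * quad_omega m)"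
    using E[of 1 2] by auto
  obtain c0 c1 where c: "A $ 2 $ 1 = 2 * (of_int c0 + of_int c1 * quad_omega m)"
    using E[of 2 1] by auto
  obtain d0 d1 where d: "A $ 2 $ 2 = 1 + 2 * (of_int d0 + of_int d1 * quad_omega m)"
    using E[of 2 2] by auto
  have "A = level2_matrix m a0 a1 b0 b1 c0 c1 d0 d1"
    by (rule mat2_eqI) (simp_all only: a b c d level2_matrix_nth)
  moreover have "A \<in> carrier (SL2 (bianchi_ring m))"
    using A by (simp add: SL2_principal_congruence_def)
  ultimately show "A \<in> carrier (SL2 (bianchi_ring m)) \<and>
    (\<exists>a0 a1 b0 b1 c0 c1 d0 d1. A = level2_matrix m a0 a1 b0 b1 c0 c1 d0 d1)"
    by blast
next
  assume "A \<in> carrier (SL2 (bianchi_ring m)) \<and>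
    (\<exists>a0 a1 b0 b1 c0 c1 d0 d1. A = level2_matrix m a0 a1 b0 b1 c0 c1 d0 d1)"
  then obtain a0 a1 b0 b1 c0 c1 d0 d1 where AC: "A \<in> carrier (SL2 (bianchi_ring m))"
    and A: "A = level2_matrix m a0 a1 b0 b1 c0 c1 d0 d1" by blast
  have "\<forall>i j. \<exists>x\<in>bianchi_ring m. A $ i $ j - (mat 1 :: complex^2^2) $ i $ j = 2 * x"
    by (simp only: forall_2 A level2_matrix_nth mat1_2 add_diff_cancel_left' diff_zero)
      (intro conjI; rule bexI, rule refl, rule bianchi_ringI, rule refl)
  thus "A \<in> SL2_principal_congruence (bianchi_ring m) 2"
    using AC by (simp add: SL2_principal_congruence_def)
qed

lemma Delta_matrices_iff:
  "A \<in> Delta_matrices m \<longleftrightarrow> A \<in> carrier (SL2 (bianchi_ring m)) \<and>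
    (\<exists>a0 a1 b0 b1 c0 c1 d0 d1. A = level2_matrix m a0 a1 b0 b1 c0 c1 d0 d1 \<and>
      (m mod 4 = 3 \<longrightarrow> [b1 = c1] (mod 2)))"
  unfolding Delta_matrices_def by (simp add: principal_congruence_2_iff)

lemma subgroup_Delta_matrices: "subgroup (Delta_matrices m) (SL2 (bianchi_ring m))"
proof -
  interpret group "SL2 (bianchi_ring m)" by (rule group_SL2_bianchi)
  show ?thesis
  proof (rule subgroupI)
    show "Delta_matrices m \<subseteq> carrier (SL2 (bianchi_ring m))"
      using Delta_matrices_iff by blast
    have "mat 1 = level2_matrix m 0 0 0 0 0 0 0 0" by (rule mat2_eqI) simp_all
    moreover have "[0 = 0 :: int] (mod 2)" by simp
    ultimately have "mat 1 \<in> Delta_matrices m"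
      using SL2_one_closed Delta_matrices_iff by metis
    thus "Delta_matrices m \<noteq> {}" by blast
  next
    fix A assume A: "A \<in> Delta_matrices m"
    then obtain a0 a1 b0 b1 c0 c1 d0 d1 where AC: "A \<in> carrier (SL2 (bianchi_ring m))"
      and A: "A = level2_matrix m a0 a1 b0 b1 c0 c1 d0 d1"
      and cong: "m mod 4 = 3 \<longrightarrow> [b1 = c1] (mod 2)" unfolding Delta_matrices_iff by blast
    have "adj2 A = level2_matrix m d0 d1 (- b0) (- b1) (- c0) (- c1) a0 a1"
      unfolding A by (rule mat2_eqI) simp_all
    moreover have "m mod 4 = 3 \<longrightarrow> [- b1 = - c1] (mod 2)"
      using cong by (simp add: cong_minus_minus_iff)
    ultimately have "adj2 A \<in> Delta_matrices m"
      unfolding Delta_matrices_iff using adj2_closed[OF AC] by blast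
    thus "inv\<^bsub>SL2 (bianchi_ring m)\<^esub> A \<in> Delta_matrices m"
      using inv_SL2_bianchi[OF AC] by simp
  next
    fix A A' assume "A \<in> Delta_matrices m" "A' \<in> Delta_matrices m"
    then obtain a0 a1 b0 b1 c0 c1 d0 d1 a0' a1' b0' b1' c0' c1' d0' d1' where
      AC: "A \<in> carrier (SL2 (bianchi_ring m))" "A' \<in> carrier (SL2 (bianchi_ring m))"
      and A: "A = level2_matrix m a0 a1 b0 b1 c0 c1 d0 d1"
        "A' = level2_matrix m a0' a1' b0' b1' c0' c1' d0' d1'"
      and cong: "m mod 4 = 3 \<longrightarrow> [b1 = c1] (mod 2)" "m mod 4 = 3 \<longrightarrow> [b1' = c1'] (mod 2)"
      unfolding Delta_matrices_iff by blast
    let ?e = "\<lambda>p q. of_int p + of_int q * quad_omega m"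
    have E: "\<exists>p q. ?e x0 x1 * ?e y0 y1 + ?e z0 z1 * ?e w0 w1 = ?e p q"
      for x0 x1 y0 y1 z0 z1 w0 w1 :: int
    proof -
      have "?e x0 x1 * ?e y0 y1 + ?e z0 z1 * ?e w0 w1 \<in> bianchi_ring m"
        by (intro bianchi_ring_add[of "_ * _"] bianchi_ring_mult) (rule bianchi_ringI[OF refl])+
      thus ?thesis unfolding bianchi_ring_def by blast
    qed
    obtain p0 p1 where p: "?e a0 a1 * ?e a0' a1' + ?e b0 b1 * ?e c0' c1' = ?e p0 p1"
      using E by blast
    obtain q0 q1 where q: "?e a0 a1 * ?e b0' b1' + ?e b0 b1 * ?e d0' d1' = ?e q0 q1"
      using E by blast
    obtain r0 r1 where r: "?e c0 c1 * ?e a0' a1' + ?e d0 d1 * ?e c0' c1' = ?e r0 r1"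
      using E by blast
    obtain s0 s1 where s: "?e c0 c1 * ?e b0' b1' + ?e d0 d1 * ?e d0' d1' = ?e s0 s1"
      using E by blast
    have e_add: "?e (x0 + y0 + 2 * z0) (x1 + y1 + 2 * z1) = ?e x0 x1 + ?e y0 y1 + 2 * ?e z0 z1"
      for x0 x1 y0 y1 z0 z1 by (simp add: algebra_simps)
    have ring: "(1 + 2 * x) * (1 + 2 * y) + 2 * z * (2 * w) = 1 + 2 * (x + y + 2 * (x * y + z * w))"
      "2 * z * (2 * w) + (1 + 2 * x) * (1 + 2 * y) = 1 + 2 * (x + y + 2 * (z * w + x * y))"
      "(1 + 2 * x) * (2 * y) + 2 * z * (1 + 2 * w) = 2 * (y + z + 2 * (x * y + z * w))"
      "2 * z * (1 + 2 * w) + (1 + 2 * x) * (2 * y) = 2 * (z + y + 2 * (z * w + x * y))"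
      for x y z w :: complex by (simp_all add: algebra_simps)
    have "A ** A' = level2_matrix m (a0 + a0' + 2 * p0) (a1 + a1' + 2 * p1)
        (b0' + b0 + 2 * q0) (b1' + b1 + 2 * q1) (c0 + c0' + 2 * r0) (c1 + c1' + 2 * r1)
        (d0 + d0' + 2 * s0) (d1 + d1' + 2 * s1)"
      unfolding A
      by (rule mat2_eqI) (simp_all only: mat2_mult level2_matrix_nth ring p q r s e_add)
    moreover have "m mod 4 = 3 \<longrightarrow> [b1' + b1 + 2 * q1 = c1 + c1' + 2 * r1] (mod 2)"
      using cong by (auto simp: cong_iff_dvd_diff)
    ultimately have "A ** A' \<in> Delta_matrices m"
      unfolding Delta_matrices_iff using SL2_mult_closed[OF AC] by blast
    thus "A \<otimes>\<^bsub>SL2 (bianchi_ring m)\<^esub> A' \<in> Delta_matrices m" by simp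
  qed
qed

lemma subgroup_Delta:
  "subgroup (carrier (Delta m)) (PSL2 (bianchi_ring m))" and group_Delta: "group (Delta m)"
proof -
  interpret group_hom "SL2 (bianchi_ring m)" "PSL2 (bianchi_ring m)"
    "r_coset (SL2 (bianchi_ring m)) {mat 1, - mat 1}"
    using normal.r_coset_hom_Mod[OF centre_normal]
    by (intro group_hom.intro group_SL2_bianchi group_PSL2_bianchi group_hom_axioms.intro)
      (simp add: PSL2_def)
  show *: "subgroup (carrier (Delta m)) (PSL2 (bianchi_ring m))"
    unfolding Delta_def PSL2_image_def
    using subgroup_img_is_subgroup[OF subgroup_Delta_matrices] by simp
  have "Delta m = (PSL2 (bianchi_ring m))\<lparr>carrier := carrier (Delta m)\<rparr>"
    by (simp add: Delta_def)
  thus "group (Delta m)"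
    using H.subgroup_imp_group[OF *] by simp
qed


section \<open>Retractions onto free groups\<close>

text \<open>
  The free group on \<open>S\<close> is realised on reduced words; the letter \<open>(x, True)\<close> stands for
  the generator \<open>x\<close> and \<open>(x, False)\<close> for its inverse.
\<close>

fun inv_letter :: "'a \<times> bool \<Rightarrow> 'a \<times> bool" where
  "inv_letter (x, b) = (x, \<not> b)"

fun reduced_word :: "('a \<times> bool) list \<Rightarrow> bool" where
  "reduced_word (l # l' # w) \<longleftrightarrow> l' \<noteq> inv_letter l \<and> reduced_word (l' # w)"
| "reduced_word _ \<longleftrightarrow> True"

fun reduced_cons :: "'a \<times> bool \<Rightarrow> ('a \<times> bool) list \<Rightarrow> ('a \<times> bool) list" where
  "reduced_cons l [] = [l]"
| "reduced_cons l (l' # w) = (if l' = inv_letter l then w else l # l' # w)"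

definition reduced_mult :: "('a \<times> bool) list \<Rightarrow> ('a \<times> bool) list \<Rightarrow> ('a \<times> bool) list" where
  "reduced_mult u v = foldr reduced_cons u v"

definition free_group :: "'a set \<Rightarrow> ('a \<times> bool) list monoid" where
  "free_group S = \<lparr>carrier = {w. reduced_word w \<and> fst ` set w \<subseteq> S},
     monoid.mult = reduced_mult, one = []\<rparr>"

definition retracts_onto :: "('a, 'b) monoid_scheme \<Rightarrow> ('c, 'd) monoid_scheme \<Rightarrow> bool" where
  "retracts_onto G H \<longleftrightarrow> (\<exists>K r. subgroup K G \<and> G\<lparr>carrier := K\<rparr> \<cong> H \<and>
     r \<in> hom G (G\<lparr>carrier := K\<rparr>) \<and> (\<forall>x\<in>K. r x = x))"

lemma inv_letter_inv_letter [simp]: "inv_letter (inv_letter l) = l"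
  by (cases l) simp

lemma fst_inv_letter [simp]: "fst (inv_letter l) = fst l"
  by (cases l) simp

lemma reduced_tl: "reduced_word (l # w) \<Longrightarrow> reduced_word w"
  by (cases w) auto

lemma reduced_reduced_cons: "reduced_word w \<Longrightarrow> reduced_word (reduced_cons l w)"
  by (cases w) (auto dest: reduced_tl)

lemma reduced_mult_reduced: "reduced_word v \<Longrightarrow> reduced_word (reduced_mult u v)"
  unfolding reduced_mult_def by (induction u) (auto intro: reduced_reduced_cons)

lemma reduced_cons_inv_letter:
  assumes "reduced_word w"
  shows "reduced_cons l (reduced_cons (inv_letter l) w) = w"
proof (cases w)
  case (Cons l' w')
  thus ?thesis using assms by (cases w') auto
qed simp

lemma reduced_mult_cons:
  assumes "reduced_word w"
  shows "reduced_mult (reduced_cons l v) w = reduced_cons l (reduced_mult v w)"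
proof (cases v)
  case (Cons l' v')
  have "reduced_mult v' w = reduced_cons l (reduced_cons (inv_letter l) (reduced_mult v' w))"
    by (rule reduced_cons_inv_letter[symmetric]) (rule reduced_mult_reduced[OF assms])
  thus ?thesis using Cons by (auto simp: reduced_mult_def)
qed (simp add: reduced_mult_def)

lemma reduced_mult_assoc:
  assumes "reduced_word w"
  shows "reduced_mult (reduced_mult u v) w = reduced_mult u (reduced_mult v w)"
proof (induction u)
  case (Cons l u)
  have "reduced_mult (reduced_mult (l # u) v) w = reduced_mult (reduced_cons l (reduced_mult u v)) w"
    by (simp add: reduced_mult_def)
  also have "\<dots> = reduced_cons l (reduced_mult u (reduced_mult v w))"
    by (simp add: reduced_mult_cons[OF assms] Cons.IH)
  finally show ?case by (simp add: reduced_mult_def)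
qed (simp add: reduced_mult_def)

lemma reduced_mult_Nil: "reduced_word w \<Longrightarrow> reduced_mult w [] = w"
proof (induction w)
  case (Cons l w)
  hence "reduced_mult (l # w) [] = reduced_cons l w"
    by (simp add: reduced_mult_def reduced_tl)
  also have "\<dots> = l # w" using Cons.prems by (cases w) auto
  finally show ?case .
qed (simp add: reduced_mult_def)

lemma set_reduced_cons: "set (reduced_cons l w) \<subseteq> insert l (set w)"
  by (cases w) auto

lemma set_reduced_mult: "set (reduced_mult u v) \<subseteq> set u \<union> set v"
  unfolding reduced_mult_def by (induction u) (use set_reduced_cons in fastforce)+

lemma fst_set_reduced_mult: "fst ` set (reduced_mult u v) \<subseteq> fst ` set u \<union> fst ` set v"
  using image_mono[OF set_reduced_mult, of fst u v] by (simp add: image_Un)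

lemma reduced_mult_inverse: "reduced_mult (rev (map inv_letter w)) w = []"
proof (induction w)
  case (Cons l w)
  thus ?case by (simp add: reduced_mult_def)
qed (simp add: reduced_mult_def)

lemma group_free_group: "group (free_group S)"
proof (rule groupI)
  fix u v assume "u \<in> carrier (free_group S)" "v \<in> carrier (free_group S)"
  thus "u \<otimes>\<^bsub>free_group S\<^esub> v \<in> carrier (free_group S)"
    using fst_set_reduced_mult[of u v]
    by (simp add: free_group_def reduced_mult_reduced) blast
next
  fix u assume u: "u \<in> carrier (free_group S)"
  let ?v = "reduced_mult (rev (map inv_letter u)) []"
  have "fst ` set ?v \<subseteq> fst ` set u"
    using fst_set_reduced_mult[of "rev (map inv_letter u)" "[]"] by (simp add: image_image)
  hence "?v \<in> carrier (free_group S)"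
    using u by (simp add: free_group_def reduced_mult_reduced) blast
  moreover have "reduced_mult ?v u = []"
    using u reduced_mult_assoc[of u "rev (map inv_letter u)" "[]"] reduced_mult_inverse[of u]
    by (simp add: free_group_def) (simp add: reduced_mult_def)
  ultimately show "\<exists>v\<in>carrier (free_group S). v \<otimes>\<^bsub>free_group S\<^esub> u = \<one>\<^bsub>free_group S\<^esub>"
    by (intro bexI[of _ ?v]) (simp_all add: free_group_def)
qed (auto simp: free_group_def reduced_mult_assoc, simp add: reduced_mult_def)

lemma free_group_generated:
  "generate (free_group S) ((\<lambda>x. [(x, True)]) ` S) = carrier (free_group S)"
proof
  interpret group "free_group S" by (rule group_free_group)
  have gens: "(\<lambda>x. [(x, True)]) ` S \<subseteq> carrier (free_group S)"
    by (auto simp: free_group_def)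
  thus "generate (free_group S) ((\<lambda>x. [(x, True)]) ` S) \<subseteq> carrier (free_group S)"
    by (rule generate_incl)
  show "carrier (free_group S) \<subseteq> generate (free_group S) ((\<lambda>x. [(x, True)]) ` S)"
  proof
    fix w assume "w \<in> carrier (free_group S)"
    thus "w \<in> generate (free_group S) ((\<lambda>x. [(x, True)]) ` S)"
    proof (induction w)
      case Nil
      thus ?case using generate.one[of "free_group S"] by (simp add: free_group_def)
    next
      case (Cons l w)
      obtain x b where l: "l = (x, b)" by (cases l)
      have x: "x \<in> S" and w: "w \<in> carrier (free_group S)"
        using Cons.prems l by (auto simp: free_group_def dest: reduced_tl)
      have "inv\<^bsub>free_group S\<^esub> [(x, True)] = [(x, False)]"
        using x by (intro inv_equality) (auto simp: free_group_def reduced_mult_def)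
      hence "[l] \<in> generate (free_group S) ((\<lambda>x. [(x, True)]) ` S)"
        using x l generate.incl[of "[(x, True)]" _ "free_group S"]
          generate.inv[of "[(x, True)]" _ "free_group S"] by (cases b) auto
      hence "[l] \<otimes>\<^bsub>free_group S\<^esub> w \<in> generate (free_group S) ((\<lambda>x. [(x, True)]) ` S)"
        using Cons.IH[OF w] by (rule generate.eng)
      moreover have "[l] \<otimes>\<^bsub>free_group S\<^esub> w = l # w"
        using Cons.prems by (cases w) (auto simp: free_group_def reduced_mult_def)
      ultimately show ?case by simp
    qed
  qed
qed

text \<open>
  Together with \<open>free_group_generated\<close>, which gives uniqueness of the extension, this is the
  universal property of the free group on \<open>S\<close>.
\<close>

lemma free_group_extend:
  assumes "group G" and f: "f \<in> S \<rightarrow> carrier G"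
  shows "\<exists>h \<in> hom (free_group S) G. \<forall>x\<in>S. h [(x, True)] = f x"
proof -
  interpret group G by fact
  define lv where "lv = (\<lambda>(x, b). if b then f x else inv\<^bsub>G\<^esub> f x)"
  define ev where "ev = (\<lambda>w. foldr (\<lambda>l g. lv l \<otimes>\<^bsub>G\<^esub> g) w \<one>\<^bsub>G\<^esub>)"
  have ev_simps [simp]: "ev [] = \<one>\<^bsub>G\<^esub>" "ev (l # w) = lv l \<otimes>\<^bsub>G\<^esub> ev w" for l w
    by (simp_all add: ev_def)
  have lv: "lv l \<in> carrier G" if "fst l \<in> S" for l
    using that f by (cases l) (auto simp: lv_def)
  have lv_inv: "lv l \<otimes>\<^bsub>G\<^esub> lv (inv_letter l) = \<one>\<^bsub>G\<^esub>" if "fst l \<in> S" for l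
    using that f by (cases l) (auto simp: lv_def Pi_iff)
  have ev: "ev w \<in> carrier G" if "fst ` set w \<subseteq> S" for w
    using that by (induction w) (auto simp: lv)
  have ev_cons: "ev (reduced_cons l w) = lv l \<otimes>\<^bsub>G\<^esub> ev w" if "fst l \<in> S" "fst ` set w \<subseteq> S" for l w
  proof (cases w)
    case (Cons l' w')
    have "lv l \<otimes>\<^bsub>G\<^esub> (lv (inv_letter l) \<otimes>\<^bsub>G\<^esub> ev w') = ev w'"
      using that Cons lv ev lv_inv by (simp flip: m_assoc)
    thus ?thesis using Cons by auto
  qed simp
  have ev_mult: "ev (reduced_mult u v) = ev u \<otimes>\<^bsub>G\<^esub> ev v"
    if "fst ` set u \<subseteq> S" "fst ` set v \<subseteq> S" for u v
    using that
  proof (induction u)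
    case Nil
    thus ?case using ev by (simp add: reduced_mult_def)
  next
    case (Cons l u)
    have "fst ` set u \<union> fst ` set v \<subseteq> S" using Cons.prems by simp
    with fst_set_reduced_mult[of u v] have "fst ` set (reduced_mult u v) \<subseteq> S"
      by (rule subset_trans)
    hence "ev (reduced_mult (l # u) v) = lv l \<otimes>\<^bsub>G\<^esub> ev (reduced_mult u v)"
      using ev_cons[of l "reduced_mult u v"] Cons.prems by (simp add: reduced_mult_def)
    thus ?case using Cons lv ev by (simp add: m_assoc)
  qed
  have "ev \<in> hom (free_group S) G"
    by (rule homI) (auto simp: free_group_def ev ev_mult)
  moreover have "\<forall>x\<in>S. ev [(x, True)] = f x" using f by (auto simp: lv_def Pi_iff)
  ultimately show ?thesis by blast
qed

end

theory Submission
  imports Defs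
begin

text \<open>
  \<open>Delta m\<close> acts on hyperbolic 3-space, and hyperbolic planes correspond to Hermitian forms of
  determinant \<open>-1\<close> up to sign. An invariant family of pairwise disjoint planes, with an invariant
  choice of signs and an invariant colouring by two colours, yields a homomorphism to the free group
  of rank 2: the image of \<open>g\<close> records the colours and directions of the planes crossed on the way
  from a base point \<open>P\<close> to \<open>g P\<close>. It splits as soon as it is onto. Two planes are disjoint if the
  pairing of their forms is at least 1 in absolute value, which holds here because all the pairings
  are odd integers. For \<open>m mod 4 \<noteq> 3\<close> the planes meet the hyperbolic plane of \<open>SL(2, \<int>)\<close>
  orthogonally in lines of the Farey tessellation, or not at all. For \<open>m mod 4 = 3\<close> such planes
  can be mapped to themselves with their sides exchanged; there the images of the hyperbolic plane
  of \<open>SL(2, \<int>)\<close> itself are used, whose forms are oriented by a congruence modulo \<open>m\<close>.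
\<close>

section \<open>Unreduced words\<close>

lemma reduced_mult_append: "reduced_mult (u @ v) w = reduced_mult u (reduced_mult v w)"
  by (simp add: reduced_mult_def)

lemma reduced_mult_cancel:
  "reduced_word w \<Longrightarrow> reduced_mult u (reduced_mult (rev (map inv_letter u)) w) = w"
proof (induction u arbitrary: w)
  case Nil
  thus ?case by (simp add: reduced_mult_def)
next
  case (Cons l u)
  have "reduced_mult (l # u) (reduced_mult (rev (map inv_letter (l # u))) w) =
      reduced_cons l (reduced_mult u (reduced_mult (rev (map inv_letter u)) (reduced_cons (inv_letter l) w)))"
    by (simp add: reduced_mult_def)
  also have "\<dots> = w"
    using Cons by (simp add: reduced_reduced_cons reduced_cons_inv_letter)
  finally show ?case .
qed

text \<open>Multiplying by the empty word brings an arbitrary word to its normal form. Words of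
  walls are built unreduced and compared only after this step.\<close>

definition reduce :: "('a \<times> bool) list \<Rightarrow> ('a \<times> bool) list" where
  "reduce w = reduced_mult w []"

lemma reduced_reduce: "reduced_word (reduce w)"
  by (simp add: reduce_def reduced_mult_reduced)

lemma reduce_append: "reduce (u @ v) = reduced_mult (reduce u) (reduce v)"
proof -
  have "reduced_mult (reduce u) (reduce v) = reduced_mult u (reduced_mult [] (reduce v))"
    unfolding reduce_def[of u] by (rule reduced_mult_assoc[OF reduced_reduce])
  thus ?thesis by (simp add: reduce_def reduced_mult_append) (simp add: reduced_mult_def)
qed

text \<open>The piece \<open>v\<close> is traversed forth and back; this is how two consecutive
  crossing words meet.\<close>

lemma reduce_cancel:
  "reduce ((u @ v) @ (rev (map inv_letter v) @ w)) = reduce (u @ w)"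
  by (simp add: reduce_def reduced_mult_append reduced_mult_cancel reduced_mult_reduced)

lemma reduce_closed: "fst ` set w \<subseteq> S \<Longrightarrow> reduce w \<in> carrier (free_group S)"
  using fst_set_reduced_mult[of w "[]"] reduced_reduce[of w]
  by (auto simp: free_group_def reduce_def)


section \<open>Splitting surjections onto free groups\<close>

text \<open>The uniqueness half of the universal property: homomorphisms are determined by their
  values on generators, and one of the two compared here is the identity.\<close>

lemma free_group_endo_id:
  assumes f: "f \<in> hom (free_group S) (free_group S)"
    and gens: "\<And>x. x \<in> S \<Longrightarrow> f [(x, True)] = [(x, True)]"
    and w: "w \<in> carrier (free_group S)"
  shows "f w = w"
proof -
  interpret group_hom "free_group S" "free_group S" f
    by (intro group_hom.intro group_hom_axioms.intro group_free_group f)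
  have "w \<in> generate (free_group S) ((\<lambda>x. [(x, True)]) ` S)"
    using w free_group_generated by blast
  thus ?thesis
  proof (induction rule: generate.induct)
    case one
    show ?case by (rule hom_one)
  next
    case (incl h)
    thus ?case using gens by auto
  next
    case (inv h)
    hence "h \<in> carrier (free_group S)" "f h = h" using gens by (auto simp: free_group_def)
    thus ?case by simp
  next
    case (eng h1 h2)
    moreover have "generate (free_group S) ((\<lambda>x. [(x, True)]) ` S) = carrier (free_group S)"
      by (rule free_group_generated)
    ultimately show ?case by simp
  qed
qed

text \<open>Freeness turns preimages of the generators into a homomorphism \<open>s\<close> with
  \<open>\<phi> \<circ> s\<close> the identity. Hence \<open>s\<close> embeds the free group, and
  \<open>s \<circ> \<phi>\<close> is the retraction onto its image.\<close>

lemma retracts_onto_free_groupI: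
  assumes "group G" and \<phi>: "\<phi> \<in> hom G (free_group S)"
    and gens: "\<And>x. x \<in> S \<Longrightarrow> \<exists>g\<in>carrier G. \<phi> g = [(x, True)]"
  shows "retracts_onto G (free_group S)"
proof -
  obtain f where f: "\<And>x. x \<in> S \<Longrightarrow> f x \<in> carrier G \<and> \<phi> (f x) = [(x, True)]"
    using gens by metis
  hence "f \<in> S \<rightarrow> carrier G" by blast
  with free_group_extend[OF \<open>group G\<close>] obtain s
    where s: "s \<in> hom (free_group S) G" and sf: "\<And>x. x \<in> S \<Longrightarrow> s [(x, True)] = f x"
    by metis
  interpret s: group_hom "free_group S" G s
    by (intro group_hom.intro group_hom_axioms.intro group_free_group \<open>group G\<close> s)
  have \<phi>s: "\<phi> (s w) = w" if "w \<in> carrier (free_group S)" for w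
    using free_group_endo_id[OF hom_compose[OF s \<phi>] _ that] f sf by simp
  let ?K = "s ` carrier (free_group S)"
  have K: "subgroup ?K G" by (rule s.img_is_subgroup)
  have "s \<in> iso (free_group S) (G\<lparr>carrier := ?K\<rparr>)"
    using \<phi>s s by (auto simp: iso_def hom_def bij_betw_def intro: inj_on_inverseI)
  hence "free_group S \<cong> G\<lparr>carrier := ?K\<rparr>" by (auto simp: is_iso_def)
  hence iso: "G\<lparr>carrier := ?K\<rparr> \<cong> free_group S"
    by (rule group.iso_sym[OF group_free_group])
  have "s \<circ> \<phi> \<in> hom G (G\<lparr>carrier := ?K\<rparr>)"
    using hom_compose[OF \<phi> s] \<phi> by (auto simp: hom_def)
  moreover have "\<forall>x\<in>?K. (s \<circ> \<phi>) x = x" using \<phi>s by auto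
  ultimately show ?thesis unfolding retracts_onto_def using K iso by blast
qed


section \<open>Words of separating walls\<close>

text \<open>The sign of \<open>val v x\<close> is the side of the wall \<open>v\<close> on which
  \<open>x\<close> lies. Disjointness of walls is encoded by \<open>nested\<close>: after a choice
  of sign, one function stays below the other at all points. The discrete set \<open>D\<close> of
  values yields local finiteness.\<close>

locale wall_space =
  fixes W :: "'w set" and X :: "'x set" and val :: "'w \<Rightarrow> 'x \<Rightarrow> real" and D :: "real set"
  assumes val_nonzero: "\<lbrakk>v \<in> W; x \<in> X\<rbrakk> \<Longrightarrow> val v x \<noteq> 0"
    and val_in: "\<lbrakk>v \<in> W; x \<in> X\<rbrakk> \<Longrightarrow> val v x \<in> D"
    and discrete: "finite (D \<inter> {- b..b})"
    and nested: "\<lbrakk>u \<in> W; v \<in> W; u \<noteq> v\<rbrakk> \<Longrightarrow>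
      \<exists>\<sigma>\<in>{1, - 1}. (\<forall>x\<in>X. \<sigma> * val v x < val u x) \<or> (\<forall>x\<in>X. val u x < \<sigma> * val v x)"
begin

section \<open>The walls separating two points, and their order\<close>

definition separating :: "'x \<Rightarrow> 'x \<Rightarrow> 'w set" where
  "separating x y = {v \<in> W. val v x * val v y < 0}"

lemma separating_commute: "separating x y = separating y x"
  by (simp add: separating_def mult.commute)

text \<open>Both functions change sign between \<open>x\<close> and \<open>y\<close>, while the
  inequality of \<open>nested\<close> keeps its direction. So they change sign the same way, up to
  \<open>\<sigma>\<close>, and the wall nearer to \<open>x\<close> is the one farther from
  \<open>y\<close>.\<close>

lemma separating_antitone:
  assumes "x \<in> X" "y \<in> X" "u \<in> separating x y" "v \<in> separating x y" "u \<noteq> v"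
  shows "\<bar>val u x\<bar> < \<bar>val v x\<bar> \<and> \<bar>val v y\<bar> < \<bar>val u y\<bar> \<or>
         \<bar>val v x\<bar> < \<bar>val u x\<bar> \<and> \<bar>val u y\<bar> < \<bar>val v y\<bar>"
proof -
  have "u \<in> W" "v \<in> W" using assms by (auto simp: separating_def)
  with nested \<open>u \<noteq> v\<close> obtain \<sigma> where \<sigma>: "\<sigma> \<in> {1, - 1}"
    and "(\<forall>x\<in>X. \<sigma> * val v x < val u x) \<or> (\<forall>x\<in>X. val u x < \<sigma> * val v x)"
    by blast
  hence "\<sigma> * val v x < val u x \<and> \<sigma> * val v y < val u y \<or>
         val u x < \<sigma> * val v x \<and> val u y < \<sigma> * val v y"
    using assms by blast
  with \<sigma> assms(3,4) show ?thesis
    unfolding separating_def mult_less_0_iff by auto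
qed

text \<open>Here \<open>u\<close> cuts off \<open>x\<close> and \<open>v\<close> cuts off
  \<open>y\<close>. The signs at the third point \<open>z\<close> decide which of the two orders
  left open by \<open>separating_antitone\<close> occurs.\<close>

lemma separating_before:
  assumes "x \<in> X" "y \<in> X" "z \<in> X" "u \<in> separating x y" "u \<in> separating x z"
    "v \<in> separating x y" "v \<in> separating y z"
  shows "\<bar>val u x\<bar> < \<bar>val v x\<bar>"
proof -
  have "u \<noteq> v" using assms by (auto simp: separating_def mult_less_0_iff)
  moreover have "u \<in> W" "v \<in> W" using assms by (auto simp: separating_def)
  ultimately obtain \<sigma> where \<sigma>: "\<sigma> \<in> {1, - 1}"
    and "(\<forall>x\<in>X. \<sigma> * val v x < val u x) \<or> (\<forall>x\<in>X. val u x < \<sigma> * val v x)"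
    using nested by metis
  hence "\<sigma> * val v x < val u x \<and> \<sigma> * val v y < val u y \<and> \<sigma> * val v z < val u z \<or>
         val u x < \<sigma> * val v x \<and> val u y < \<sigma> * val v y \<and> val u z < \<sigma> * val v z"
    using assms by blast
  with \<sigma> assms(4-7) show ?thesis
    unfolding separating_def mult_less_0_iff by auto
qed

lemma inj_on_separating:
  assumes "x \<in> X" "y \<in> X"
  shows "inj_on (\<lambda>v. \<bar>val v x\<bar>) (separating x y)"
  using separating_antitone[OF assms] by (fastforce intro!: inj_onI)

text \<open>Fix one separating wall \<open>u\<close>. Every other one is smaller than
  \<open>u\<close> in absolute value at \<open>x\<close> or at \<open>y\<close>; only finitely many
  values in \<open>D\<close> are that small, and each belongs to at most one separating
  wall.\<close>

lemma finite_separating: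
  assumes X: "x \<in> X" "y \<in> X"
  shows "finite (separating x y)"
proof (cases "separating x y = {}")
  case False
  then obtain u where u: "u \<in> separating x y" by blast
  have fin: "finite {v \<in> separating p q. \<bar>val v p\<bar> \<le> b}" if "p \<in> X" "q \<in> X" for p q b
  proof (rule finite_imageD)
    have "(\<lambda>v. \<bar>val v p\<bar>) ` {v \<in> separating p q. \<bar>val v p\<bar> \<le> b} \<subseteq> abs ` (D \<inter> {- b..b})"
      using val_in \<open>p \<in> X\<close> by (auto simp: separating_def abs_le_iff)
    thus "finite ((\<lambda>v. \<bar>val v p\<bar>) ` {v \<in> separating p q. \<bar>val v p\<bar> \<le> b})"
      using discrete finite_subset by blast
    show "inj_on (\<lambda>v. \<bar>val v p\<bar>) {v \<in> separating p q. \<bar>val v p\<bar> \<le> b}"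
      by (rule inj_on_subset[OF inj_on_separating[OF that]]) blast
  qed
  have "separating x y \<subseteq> {v \<in> separating x y. \<bar>val v x\<bar> \<le> \<bar>val u x\<bar>} \<union>
      {v \<in> separating y x. \<bar>val v y\<bar> \<le> \<bar>val u y\<bar>}"
    using separating_antitone[OF X u] separating_commute[of x y] by fastforce
  thus ?thesis by (rule finite_subset) (intro finite_UnI fin X)
qed simp

text \<open>Increasing absolute value at \<open>x\<close> stands for the order in which a path from
  \<open>x\<close> meets the walls. Strictness excludes repetitions.\<close>

definition wall_list :: "'x \<Rightarrow> 'w set \<Rightarrow> 'w list \<Rightarrow> bool" where
  "wall_list x S vs \<longleftrightarrow> set vs = S \<and> sorted_wrt (\<lambda>u v. \<bar>val u x\<bar> < \<bar>val v x\<bar>) vs"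

lemma wall_list_exists:
  assumes "x \<in> X" "y \<in> X" "S \<subseteq> separating x y"
  shows "\<exists>vs. wall_list x S vs"
proof -
  let ?k = "\<lambda>v. \<bar>val v x\<bar>"
  have inj: "inj_on ?k S" by (rule inj_on_subset[OF inj_on_separating]) fact+
  have fin: "finite S" using assms finite_separating finite_subset by blast
  \<comment> \<open>The values are sorted instead of the walls; injectivity recovers the walls from
    them.\<close>
  let ?ks = "sorted_list_of_set (?k ` S)"
  let ?i = "the_inv_into S ?k"
  have "sorted_wrt (<) ?ks" using fin by simp
  hence "sorted_wrt (\<lambda>k l. ?k (?i k) < ?k (?i l)) ?ks"
    by (rule sorted_wrt_mono_rel[rotated]) (use fin in \<open>simp add: f_the_inv_into_f[OF inj]\<close>)
  hence "sorted_wrt (\<lambda>u v. ?k u < ?k v) (map ?i ?ks)" by (simp add: sorted_wrt_map)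
  moreover have "set (map ?i ?ks) = S"
    using fin by (simp add: image_image the_inv_into_f_f[OF inj])
  ultimately show ?thesis unfolding wall_list_def by blast
qed

lemma wall_list_unique:
  assumes "x \<in> X" "y \<in> X" "S \<subseteq> separating x y" "wall_list x S us" "wall_list x S vs"
  shows "us = vs"
proof -
  let ?k = "\<lambda>v. \<bar>val v x\<bar>"
  have "sorted_wrt (<) (map ?k us)" "sorted_wrt (<) (map ?k vs)"
    "set (map ?k us) = set (map ?k vs)"
    using assms(4,5) by (auto simp: wall_list_def sorted_wrt_map)
  hence "map ?k us = map ?k vs" by (metis strict_sorted_equal)
  moreover have "inj_on ?k (set us \<union> set vs)"
    by (rule inj_on_subset[OF inj_on_separating[OF assms(1,2)]]) (use assms(3-) in \<open>auto simp: wall_list_def\<close>)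
  ultimately show ?thesis using map_inj_on by blast
qed

definition walls_between :: "'x \<Rightarrow> 'x \<Rightarrow> 'w list" where
  "walls_between x y = (THE vs. wall_list x (separating x y) vs)"

lemma walls_between_eqI:
  assumes "x \<in> X" "y \<in> X" "wall_list x (separating x y) vs"
  shows "walls_between x y = vs"
  unfolding walls_between_def
  by (rule the_equality) (use assms wall_list_unique[OF assms(1,2) order_refl] in auto)

lemma walls_between:
  assumes "x \<in> X" "y \<in> X"
  shows "wall_list x (separating x y) (walls_between x y)"
  using wall_list_exists[OF assms order_refl] walls_between_eqI[OF assms] by blast

text \<open>The Boolean is the side of the end point \<open>y\<close>, hence the direction of
  crossing; reversing the path inverts each letter.\<close>

definition crossing_word :: "('w \<Rightarrow> 'c) \<Rightarrow> 'x \<Rightarrow> 'x \<Rightarrow> ('c \<times> bool) list" where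
  "crossing_word col x y = map (\<lambda>v. (col v, val v y > 0)) (walls_between x y)"

lemma wall_list_reverse:
  assumes "x \<in> X" "y \<in> X" "S \<subseteq> separating x y" "wall_list x S vs"
  shows "wall_list y S (rev vs)"
proof -
  have "sorted_wrt (\<lambda>u v. \<bar>val v y\<bar> < \<bar>val u y\<bar>) vs"
    by (rule sorted_wrt_mono_rel[of _ "\<lambda>u v. \<bar>val u x\<bar> < \<bar>val v x\<bar>"])
      (use assms separating_antitone[OF assms(1,2)] in \<open>fastforce simp: wall_list_def\<close>)+
  thus ?thesis using assms(4) by (simp add: wall_list_def sorted_wrt_rev)
qed

text \<open>
  The walls separating one of the three points from the other two form the legs of a tripod,
  so that the two words on the left share a leg, read in opposite directions.
\<close>

lemma crossing_word_cocycle: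
  assumes x: "x \<in> X" and y: "y \<in> X" and z: "z \<in> X"
  shows "reduce (crossing_word col x y @ crossing_word col y z) = reduce (crossing_word col x z)"
proof -
  \<comment> \<open>The legs at \<open>x\<close>, \<open>y\<close> and \<open>z\<close>. As no point
    is on a wall, a wall that separates one of the three pairs separates exactly two of
    them.\<close>
  define A B C where "A = separating x y \<inter> separating x z"
    and "B = separating x y \<inter> separating y z" and "C = separating x z \<inter> separating y z"
  note S = separating_commute[of x y] separating_commute[of x z] separating_commute[of y z]
  have split: "separating x y = A \<union> B" "separating y z = B \<union> C" "separating x z = A \<union> C"
    using val_nonzero x y z unfolding A_def B_def C_def separating_def
    by (auto simp: mult_less_0_iff) (meson linorder_neqE_linordered_idom)+
  obtain as where as: "wall_list x A as" using wall_list_exists[OF x y, of A] A_def by blast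
  obtain bs where bs: "wall_list x B bs" using wall_list_exists[OF x y, of B] B_def by blast
  obtain cs where cs: "wall_list z C cs" using wall_list_exists[OF z x, of C] C_def S by blast
  have bs': "wall_list y B (rev bs)"
    by (rule wall_list_reverse[OF x y _ bs]) (simp add: B_def)
  have csx: "wall_list x C (rev cs)" by (rule wall_list_reverse[OF z x _ cs]) (auto simp: C_def S)
  have csy: "wall_list y C (rev cs)" by (rule wall_list_reverse[OF z y _ cs]) (auto simp: C_def S)
  have append: "wall_list p (P \<union> Q) (ps @ qs)"
    if "wall_list p P ps" "wall_list p Q qs"
      "\<And>u v. u \<in> P \<Longrightarrow> v \<in> Q \<Longrightarrow> \<bar>val u p\<bar> < \<bar>val v p\<bar>" for p P Q ps qs
    using that by (auto simp: wall_list_def sorted_wrt_append)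
  have xy: "walls_between x y = as @ bs"
  proof (rule walls_between_eqI[OF x y], unfold split, rule append[OF as bs])
    show "\<bar>val u x\<bar> < \<bar>val v x\<bar>" if "u \<in> A" "v \<in> B" for u v
      by (rule separating_before[OF x y z]) (use that in \<open>auto simp: A_def B_def\<close>)
  qed
  have yz: "walls_between y z = rev bs @ rev cs"
  proof (rule walls_between_eqI[OF y z], unfold split, rule append[OF bs' csy])
    show "\<bar>val u y\<bar> < \<bar>val v y\<bar>" if "u \<in> B" "v \<in> C" for u v
      by (rule separating_before[OF y z x]) (use that S in \<open>auto simp: B_def C_def\<close>)
  qed
  have xz: "walls_between x z = as @ rev cs"
  proof (rule walls_between_eqI[OF x z], unfold split, rule append[OF as csx])
    show "\<bar>val u x\<bar> < \<bar>val v x\<bar>" if "u \<in> A" "v \<in> C" for u v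
      by (rule separating_before[OF x z y]) (use that S in \<open>auto simp: A_def C_def\<close>)
  qed
  \<comment> \<open>Walls in \<open>A\<close> have \<open>y\<close> and \<open>z\<close> on the same
    side, so the letters agree; walls in \<open>B\<close> have them on opposite sides, so the
    letters are inverse.\<close>
  let ?l = "\<lambda>p v. (col v, val v p > 0)"
  have a: "map (?l y) as = map (?l z) as"
    using as by (auto simp: wall_list_def A_def separating_def mult_less_0_iff)
  have b: "map (?l z) (rev bs) = rev (map inv_letter (map (?l y) bs))"
    using bs by (auto simp: rev_map wall_list_def B_def separating_def mult_less_0_iff)
  have "crossing_word col x y @ crossing_word col y z =
      (map (?l y) as @ map (?l y) bs) @ (rev (map inv_letter (map (?l y) bs)) @ map (?l z) (rev cs))"
    unfolding crossing_word_def xy yz using b by simp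
  also have "reduce \<dots> = reduce (map (?l y) as @ map (?l z) (rev cs))"
    by (rule reduce_cancel)
  also have "map (?l y) as @ map (?l z) (rev cs) = crossing_word col x z"
    unfolding crossing_word_def xz a by simp
  finally show ?thesis .
qed

end

text \<open>The points are the group elements: \<open>g\<close> stands for the translate of the base
  point by \<open>g\<close>. The action on walls is a right action, like that of matrices on forms
  by \<open>herm_act\<close>.\<close>

locale wall_action = group M + wall_space W "carrier M" val D
  for M :: "('x, 'b) monoid_scheme" and W :: "'w set" and val D +
  fixes act :: "'w \<Rightarrow> 'x \<Rightarrow> 'w" and col :: "'w \<Rightarrow> 'c" and C :: "'c set"
  assumes act_closed: "\<lbrakk>v \<in> W; g \<in> carrier M\<rbrakk> \<Longrightarrow> act v g \<in> W"
    and act_one: "v \<in> W \<Longrightarrow> act v \<one>\<^bsub>M\<^esub> = v"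
    and act_mult: "\<lbrakk>v \<in> W; g \<in> carrier M; h \<in> carrier M\<rbrakk> \<Longrightarrow> act v (g \<otimes>\<^bsub>M\<^esub> h) = act (act v g) h"
    and val_act: "\<lbrakk>v \<in> W; g \<in> carrier M; h \<in> carrier M\<rbrakk> \<Longrightarrow> val v (g \<otimes>\<^bsub>M\<^esub> h) = val (act v g) h"
    and col_closed: "v \<in> W \<Longrightarrow> col v \<in> C"
    and col_act: "\<lbrakk>v \<in> W; g \<in> carrier M\<rbrakk> \<Longrightarrow> col (act v g) = col v"
begin

section \<open>The crossing homomorphism\<close>

lemma val_act_one: "\<lbrakk>v \<in> W; g \<in> carrier M\<rbrakk> \<Longrightarrow> val (act v g) \<one>\<^bsub>M\<^esub> = val v g"
  using val_act[of v g "\<one>\<^bsub>M\<^esub>"] by simp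

lemma act_separating:
  assumes g: "g \<in> carrier M" and h: "h \<in> carrier M"
  shows "(\<lambda>v. act v g) ` separating g (g \<otimes>\<^bsub>M\<^esub> h) = separating \<one>\<^bsub>M\<^esub> h"
proof
  show "(\<lambda>v. act v g) ` separating g (g \<otimes>\<^bsub>M\<^esub> h) \<subseteq> separating \<one>\<^bsub>M\<^esub> h"
    using assms by (auto simp: separating_def act_closed val_act val_act_one)
  show "separating \<one>\<^bsub>M\<^esub> h \<subseteq> (\<lambda>v. act v g) ` separating g (g \<otimes>\<^bsub>M\<^esub> h)"
  proof
    fix v assume v: "v \<in> separating \<one>\<^bsub>M\<^esub> h"
    hence vW: "v \<in> W" by (simp add: separating_def)
    let ?u = "act v (inv\<^bsub>M\<^esub> g)"
    have u: "?u \<in> W" "act ?u g = v"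
      using vW g act_closed act_one by (simp_all flip: act_mult)
    hence "?u \<in> separating g (g \<otimes>\<^bsub>M\<^esub> h)"
      using v assms val_act_one[OF u(1) g] by (simp add: separating_def val_act)
    thus "v \<in> (\<lambda>v. act v g) ` separating g (g \<otimes>\<^bsub>M\<^esub> h)" using u by force
  qed
qed

text \<open>Acting by \<open>g\<close> carries the walls on the left to those on the right and
  preserves the values at corresponding points, hence order, directions and colours.\<close>

lemma crossing_word_translate:
  assumes g: "g \<in> carrier M" and h: "h \<in> carrier M"
  shows "crossing_word col g (g \<otimes>\<^bsub>M\<^esub> h) = crossing_word col \<one>\<^bsub>M\<^esub> h"
proof -
  let ?vs = "walls_between g (g \<otimes>\<^bsub>M\<^esub> h)"
  have vs: "wall_list g (separating g (g \<otimes>\<^bsub>M\<^esub> h)) ?vs"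
    using g h by (intro walls_between) simp_all
  hence W: "set ?vs \<subseteq> W" by (auto simp: wall_list_def separating_def)
  have "sorted_wrt (\<lambda>u v. \<bar>val (act u g) \<one>\<^bsub>M\<^esub>\<bar> < \<bar>val (act v g) \<one>\<^bsub>M\<^esub>\<bar>) ?vs"
    by (rule sorted_wrt_mono_rel[of _ "\<lambda>u v. \<bar>val u g\<bar> < \<bar>val v g\<bar>"])
      (use vs W g val_act_one in \<open>auto simp: wall_list_def subset_iff\<close>)
  hence "wall_list \<one>\<^bsub>M\<^esub> (separating \<one>\<^bsub>M\<^esub> h) (map (\<lambda>v. act v g) ?vs)"
    using vs act_separating[OF assms] by (simp add: wall_list_def sorted_wrt_map)
  hence "walls_between \<one>\<^bsub>M\<^esub> h = map (\<lambda>v. act v g) ?vs"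
    using h by (intro walls_between_eqI) simp_all
  thus ?thesis using W g h by (auto simp: crossing_word_def col_act val_act)
qed

definition crossing :: "'x \<Rightarrow> ('c \<times> bool) list" where
  "crossing g = reduce (crossing_word col \<one>\<^bsub>M\<^esub> g)"

text \<open>The path to the product is broken at \<open>g\<close>; translation turns its second half
  into the path for \<open>h\<close>.\<close>

lemma crossing_hom: "crossing \<in> hom M (free_group C)"
proof (rule homI)
  fix g h assume g: "g \<in> carrier M" and h: "h \<in> carrier M"
  show "crossing g \<in> carrier (free_group C)"
    unfolding crossing_def using walls_between[OF one_closed g] col_closed
    by (intro reduce_closed) (auto simp: crossing_word_def wall_list_def separating_def)
  have "crossing (g \<otimes>\<^bsub>M\<^esub> h) =
      reduce (crossing_word col \<one>\<^bsub>M\<^esub> g @ crossing_word col g (g \<otimes>\<^bsub>M\<^esub> h))"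
    unfolding crossing_def using g h by (intro crossing_word_cocycle[symmetric]) simp_all
  thus "crossing (g \<otimes>\<^bsub>M\<^esub> h) = crossing g \<otimes>\<^bsub>free_group C\<^esub> crossing h"
    by (simp add: crossing_word_translate[OF g h] reduce_append crossing_def free_group_def)
qed

text \<open>Serves to identify the images of a matrix and its negative, which move the base point
  alike.\<close>

lemma crossing_cong:
  assumes g: "g \<in> carrier M" and h: "h \<in> carrier M" and eq: "\<And>v. v \<in> W \<Longrightarrow> val v g = val v h"
  shows "crossing g = crossing h"
proof -
  have "separating \<one>\<^bsub>M\<^esub> g = separating \<one>\<^bsub>M\<^esub> h"
    using eq by (auto simp: separating_def)
  hence "walls_between \<one>\<^bsub>M\<^esub> g = walls_between \<one>\<^bsub>M\<^esub> h"
    by (simp add: walls_between_def)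
  thus ?thesis
    using walls_between[OF one_closed h] eq
    by (auto simp: crossing_def crossing_word_def wall_list_def separating_def
        intro!: arg_cong[of _ _ reduce])
qed

end

section \<open>Hermitian forms as oriented walls\<close>

definition ctrans :: "complex^2^2 \<Rightarrow> complex^2^2" where
  "ctrans A = (\<chi> i j. cnj (A $ j $ i))"

lemma ctrans_nth [simp]: "ctrans A $ i $ j = cnj (A $ j $ i)"
  by (simp add: ctrans_def)

lemma ctrans_mult: "ctrans (A ** B) = ctrans B ** ctrans A"
  by (simp add: vec_eq_iff mat2_mult mult.commute)

lemma ctrans_mat_1 [simp]: "ctrans (mat 1) = mat 1"
  by (rule mat2_eqI) simp_all

lemma det_ctrans: "det (ctrans A) = cnj (det A)"
  by (simp add: det_2 mult.commute)

definition herm_act :: "complex^2^2 \<Rightarrow> complex^2^2 \<Rightarrow> complex^2^2" where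
  "herm_act H g = ctrans g ** H ** g"

lemma herm_act_one [simp]: "herm_act H (mat 1) = H"
  by (simp add: herm_act_def)

lemma herm_act_mult: "herm_act H (g ** h) = herm_act (herm_act H g) h"
  by (simp add: herm_act_def ctrans_mult matrix_mul_assoc)

lemma det_herm_act: "det g = 1 \<Longrightarrow> det (herm_act H g) = det H"
  by (simp add: herm_act_def det_mul det_ctrans)

lemma herm_act_uminus: "herm_act H (- g) = herm_act H g"
  by (rule mat2_eqI) (simp_all add: herm_act_def mat2_mult algebra_simps)

lemma cmod_squared: "(cmod z)\<^sup>2 = Re z * Re z + Im z * Im z"
  unfolding cmod_power2 by (simp add: power2_eq_square)

definition herm :: "real \<Rightarrow> real \<Rightarrow> complex \<Rightarrow> complex^2^2" where
  "herm a c b = vector [vector [of_real a, b], vector [cnj b, of_real c]]"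

lemma herm_nth [simp]:
  "herm a c b $ 1 $ 1 = of_real a" "herm a c b $ 1 $ 2 = b"
  "herm a c b $ 2 $ 1 = cnj b" "herm a c b $ 2 $ 2 = of_real c"
  by (simp_all add: herm_def)

lemma herm_eq_iff: "herm a c b = herm a' c' b' \<longleftrightarrow> a = a' \<and> c = c' \<and> b = b'"
  by (metis herm_nth(1,2,4) of_real_eq_iff)

lemma det_herm: "det (herm a c b) = of_real (a * c - (cmod b)\<^sup>2)"
  by (simp add: det_2 complex_norm_square[symmetric])

lemma herm_act_herm:
  "herm_act (herm a c b) g = herm
     (a * (cmod (g $ 1 $ 1))\<^sup>2 + c * (cmod (g $ 2 $ 1))\<^sup>2 + 2 * Re (b * cnj (g $ 1 $ 1) * g $ 2 $ 1))
     (a * (cmod (g $ 1 $ 2))\<^sup>2 + c * (cmod (g $ 2 $ 2))\<^sup>2 + 2 * Re (b * cnj (g $ 1 $ 2) * g $ 2 $ 2))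
     (of_real a * cnj (g $ 1 $ 1) * g $ 1 $ 2 + b * cnj (g $ 1 $ 1) * g $ 2 $ 2 +
      cnj b * cnj (g $ 2 $ 1) * g $ 1 $ 2 + of_real c * cnj (g $ 2 $ 1) * g $ 2 $ 2)"
  (is "_ = herm ?a ?c ?b")
proof (rule mat2_eqI)
  have diag: "of_real (a * (cmod x)\<^sup>2 + c * (cmod z)\<^sup>2 + 2 * Re w) =
      of_real a * (x * cnj x) + of_real c * (z * cnj z) + (w + cnj w)" for x z w
    by (simp only: of_real_add of_real_mult complex_norm_square complex_add_cnj)
  show "herm_act (herm a c b) g $ 1 $ 1 = herm ?a ?c ?b $ 1 $ 1"
    "herm_act (herm a c b) g $ 2 $ 2 = herm ?a ?c ?b $ 2 $ 2"
    unfolding herm_nth diag by (simp_all add: herm_act_def mat2_mult algebra_simps)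
qed (simp_all add: herm_act_def mat2_mult algebra_simps)

text \<open>\<open>htrace (herm_act H g)\<close> is the real part of the trace of
  \<open>H ** (g ** ctrans g)\<close>: the value of \<open>H\<close> at the point of hyperbolic
  3-space given by a positive definite matrix, if \<open>g\<close> is invertible.\<close>

definition htrace :: "complex^2^2 \<Rightarrow> real" where
  "htrace H = Re (H $ 1 $ 1 + H $ 2 $ 2)"

lemma htrace_herm [simp]: "htrace (herm a c b) = a + c"
  by (simp add: htrace_def)

lemma htrace_act_diff: "htrace (herm_act (H - K) g) = htrace (herm_act H g) - htrace (herm_act K g)"
  by (simp add: htrace_def herm_act_def mat2_mult algebra_simps)

lemma htrace_act_add: "htrace (herm_act (H + K) g) = htrace (herm_act H g) + htrace (herm_act K g)"
  by (simp add: htrace_def herm_act_def mat2_mult algebra_simps)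

section \<open>Semidefinite forms have constant sign on hyperbolic space\<close>

lemma hermitian_form_complete_square:
  "a * (a * (cmod x)\<^sup>2 + c * (cmod z)\<^sup>2 + 2 * Re (b * cnj x * z)) =
   (cmod (of_real a * x + b * z))\<^sup>2 + (a * c - (cmod b)\<^sup>2) * (cmod z)\<^sup>2"
  unfolding cmod_squared by (simp add: algebra_simps)

text \<open>A nonzero positive semidefinite form has a radical of dimension at most one, so it is
  positive on one of the two independent columns of \<open>M\<close>.\<close>

lemma htrace_act_pos:
  assumes sd: "(cmod b)\<^sup>2 \<le> a * c" and pos: "a + c > 0" and M: "det M \<noteq> 0"
  shows "htrace (herm_act (herm a c b) M) > 0"
proof -
  let ?q = "\<lambda>x z. a * (cmod x)\<^sup>2 + c * (cmod z)\<^sup>2 + 2 * Re (b * cnj x * z)"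
  have tr: "htrace (herm_act (herm a c b) M) = ?q (M$1$1) (M$2$1) + ?q (M$1$2) (M$2$2)"
    unfolding herm_act_herm htrace_herm ..
  have ac: "a * c \<ge> 0" using sd zero_le_power2[of "cmod b"] by linarith
  show ?thesis
  proof (cases "a = 0")
    case True
    hence "b = 0" "c > 0" using sd pos by auto
    moreover have "M$2$1 \<noteq> 0 \<or> M$2$2 \<noteq> 0" using M by (auto simp: det_2)
    ultimately show ?thesis unfolding tr
      using True by (auto simp: add_pos_nonneg add_nonneg_pos)
  next
    case False
    have a: "a > 0"
      using False ac pos by (auto simp: zero_le_mult_iff)
    have e: "a * ?q x z \<ge> (cmod (of_real a * x + b * z))\<^sup>2" for x z
      unfolding hermitian_form_complete_square using sd by simp
    \<comment> \<open>The nonzero row vector with entries \<open>a\<close> and \<open>b\<close> is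
      not annihilated by an invertible matrix.\<close>
    have "of_real a * M$1$1 + b * M$2$1 \<noteq> 0 \<or> of_real a * M$1$2 + b * M$2$2 \<noteq> 0"
    proof (rule ccontr)
      assume "\<not> ?thesis"
      hence "of_real a * M$1$1 = - b * M$2$1" "of_real a * M$1$2 = - b * M$2$2"
        by (simp_all add: eq_neg_iff_add_eq_0)
      moreover have "of_real a * det M = (of_real a * M$1$1) * M$2$2 - (of_real a * M$1$2) * M$2$1"
        by (simp add: det_2 algebra_simps)
      ultimately have "of_real a * det M = 0" by simp
      thus False using a M by simp
    qed
    hence "0 < (cmod (of_real a * M$1$1 + b * M$2$1))\<^sup>2 + (cmod (of_real a * M$1$2 + b * M$2$2))\<^sup>2"
      by (auto simp: add_pos_nonneg add_nonneg_pos)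
    also have "\<dots> \<le> a * htrace (herm_act (herm a c b) M)"
      unfolding tr distrib_left[of a "?q _ _"] by (intro add_mono e)
    finally show ?thesis using a by (simp add: zero_less_mult_iff)
  qed
qed

text \<open>Applied to the difference or the sum of two walls, this yields the comparison required
  by \<open>nested\<close>. A semidefinite form with trace 0 vanishes, so the sign of the trace
  decides.\<close>

lemma htrace_act_sign:
  assumes H: "H = herm a c b" "H \<noteq> 0" and sd: "0 \<le> Re (det H)"
  shows "(\<forall>M. det M \<noteq> 0 \<longrightarrow> htrace (herm_act H M) > 0) \<or> (\<forall>M. det M \<noteq> 0 \<longrightarrow> htrace (herm_act H M) < 0)"
proof -
  have sd: "(cmod b)\<^sup>2 \<le> a * c" using sd unfolding H(1) det_herm by simp
  have "a + c \<noteq> 0"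
  proof
    assume *: "a + c = 0"
    hence "c = - a" by simp
    hence "(cmod b)\<^sup>2 + a\<^sup>2 \<le> 0" using sd by (simp add: power2_eq_square)
    hence "b = 0 \<and> a = 0" by (simp add: sum_power2_le_zero_iff)
    hence "H = 0" unfolding H using * by (intro mat2_eqI) simp_all
    thus False using H by simp
  qed
  moreover have "htrace (herm_act H M) < 0" if "a + c < 0" "det M \<noteq> 0" for M
  proof -
    have "0 < htrace (herm_act (herm (- a) (- c) (- b)) M)"
      by (rule htrace_act_pos) (use sd that in simp_all)
    also have "herm (- a) (- c) (- b) = 0 - H" unfolding H by (rule mat2_eqI) simp_all
    finally show ?thesis unfolding htrace_act_diff by (simp add: htrace_def herm_act_def mat2_mult)
  qed
  moreover have "0 < htrace (herm_act H M)" if "0 < a + c" "det M \<noteq> 0" for M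
    unfolding H by (rule htrace_act_pos[OF sd that])
  ultimately show ?thesis by (cases "0 < a + c") simp_all
qed


section \<open>Wall systems for \<open>Delta\<close>\<close>

abbreviation Delta_SL :: "nat \<Rightarrow> (complex^2^2) monoid" where
  "Delta_SL m \<equiv> (SL2 (bianchi_ring m))\<lparr>carrier := Delta_matrices m\<rparr>"

lemma group_Delta_SL: "group (Delta_SL m)"
  by (rule group.subgroup_imp_group[OF group_SL2_bianchi subgroup_Delta_matrices])

lemma det_Delta: "A \<in> Delta_matrices m \<Longrightarrow> det A = 1"
  by (simp add: Delta_matrices_iff SL2_def)

lemma Delta_matrices_uminus:
  assumes "A \<in> Delta_matrices m"
  shows "- A \<in> Delta_matrices m"
proof -
  obtain a0 a1 b0 b1 c0 c1 d0 d1 where AC: "A \<in> carrier (SL2 (bianchi_ring m))"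
    and A: "A = level2_matrix m a0 a1 b0 b1 c0 c1 d0 d1" and cong: "m mod 4 = 3 \<longrightarrow> [b1 = c1] (mod 2)"
    using assms unfolding Delta_matrices_iff by blast
  have "- A = level2_matrix m (- 1 - a0) (- a1) (- b0) (- b1) (- c0) (- c1) (- 1 - d0) (- d1)"
    unfolding A by (rule mat2_eqI) (simp_all add: algebra_simps)
  moreover have "m mod 4 = 3 \<longrightarrow> [- b1 = - c1] (mod 2)" using cong by (simp add: cong_minus_minus_iff)
  moreover have "- A \<in> carrier (SL2 (bianchi_ring m))"
    using AC by (simp add: SL2_carrier_iff bianchi_ring_uminus)
  ultimately show ?thesis unfolding Delta_matrices_iff by blast
qed

lemma Delta_hom_factor:
  assumes \<phi>: "\<phi> \<in> hom (Delta_SL m) F" and neg: "\<And>A. A \<in> Delta_matrices m \<Longrightarrow> \<phi> (- A) = \<phi> A"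
  shows "\<exists>\<Phi> \<in> hom (Delta m) F. \<forall>A\<in>Delta_matrices m. \<exists>C\<in>carrier (Delta m). \<Phi> C = \<phi> A"
proof -
  let ?Z = "{mat 1, - mat 1 :: complex^2^2}"
  let ?c = "\<lambda>A. ?Z #>\<^bsub>SL2 (bianchi_ring m)\<^esub> A"
  \<comment> \<open>On a coset, which consists of a matrix and its negative, \<open>\<phi>\<close>
    has a single value.\<close>
  define \<Phi> where "\<Phi> = (\<lambda>C. the_elem (\<phi> ` C))"
  have \<Phi>: "\<Phi> (?c A) = \<phi> A" if "A \<in> Delta_matrices m" for A
  proof -
    have "?c A = {A, - A}" by (auto simp: r_coset_def neg_mat1_mult)
    thus ?thesis using neg[OF that] by (simp add: \<Phi>_def)
  qed
  have carr: "carrier (Delta m) = ?c ` Delta_matrices m"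
    by (simp add: Delta_def PSL2_image_def)
  have mult: "?c A \<otimes>\<^bsub>Delta m\<^esub> ?c B = ?c (A ** B)"
    if "A \<in> Delta_matrices m" "B \<in> Delta_matrices m" for A B
    using normal.rcos_sum[OF centre_normal[of m], of A B] that
    by (simp add: Delta_def PSL2_def FactGroup_def Delta_matrices_iff)
  have closed: "A ** B \<in> Delta_matrices m"
    if "A \<in> Delta_matrices m" "B \<in> Delta_matrices m" for A B
    using subgroup.m_closed[OF subgroup_Delta_matrices that] by simp
  have "\<Phi> \<in> hom (Delta m) F"
  proof (rule homI)
    fix C assume "C \<in> carrier (Delta m)"
    thus "\<Phi> C \<in> carrier F" using \<phi> unfolding carr by (auto simp: \<Phi> hom_def)
  next
    fix C C' assume "C \<in> carrier (Delta m)" "C' \<in> carrier (Delta m)"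
    thus "\<Phi> (C \<otimes>\<^bsub>Delta m\<^esub> C') = \<Phi> C \<otimes>\<^bsub>F\<^esub> \<Phi> C'"
      using \<phi> unfolding carr by (auto simp: mult \<Phi> closed hom_def)
  qed
  thus ?thesis using \<Phi> carr by blast
qed

text \<open>\<open>W0\<close> and \<open>W1\<close> are the two colour classes and \<open>E\<close>
  represents the base point. A semidefinite sum or difference expresses disjointness of planes;
  \<open>oriented\<close> says that no plane occurs with both signs. As 0 is not in
  \<open>D\<close>, no translate of the base point is on a wall.\<close>

locale hermitian_walls =
  fixes m :: nat and W0 W1 :: "(complex^2^2) set" and E :: "complex^2^2" and D :: "real set"
  assumes hermitian: "v \<in> W0 \<union> W1 \<Longrightarrow> \<exists>a c b. v = herm a c b"
    and disjoint: "\<lbrakk>u \<in> W0 \<union> W1; v \<in> W0 \<union> W1\<rbrakk> \<Longrightarrow> 0 \<le> Re (det (u - v)) \<or> 0 \<le> Re (det (u + v))"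
    and oriented: "v \<in> W0 \<union> W1 \<Longrightarrow> - v \<notin> W0 \<union> W1"
    and colours: "W0 \<inter> W1 = {}"
    and W0_act: "\<lbrakk>v \<in> W0; g \<in> Delta_matrices m\<rbrakk> \<Longrightarrow> herm_act v g \<in> W0"
    and W1_act: "\<lbrakk>v \<in> W1; g \<in> Delta_matrices m\<rbrakk> \<Longrightarrow> herm_act v g \<in> W1"
    and base: "det E \<noteq> 0"
    and base_val: "v \<in> W0 \<union> W1 \<Longrightarrow> htrace (herm_act v E) \<in> D"
    and D: "0 \<notin> D" "finite (D \<inter> {- r..r})"
begin

definition wval :: "complex^2^2 \<Rightarrow> complex^2^2 \<Rightarrow> real" where
  "wval v g = htrace (herm_act v (g ** E))"

definition wcol :: "complex^2^2 \<Rightarrow> nat" where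
  "wcol v = (if v \<in> W0 then 0 else 1)"

lemma wval_in:
  assumes "v \<in> W0 \<union> W1" "g \<in> Delta_matrices m"
  shows "wval v g \<in> D"
  unfolding wval_def herm_act_mult by (rule base_val) (use assms W0_act W1_act in blast)

lemma wval_nested:
  assumes u: "u \<in> W0 \<union> W1" and v: "v \<in> W0 \<union> W1" and "u \<noteq> v"
  shows "\<exists>\<sigma>\<in>{1, - 1}. (\<forall>g\<in>Delta_matrices m. \<sigma> * wval v g < wval u g) \<or>
    (\<forall>g\<in>Delta_matrices m. wval u g < \<sigma> * wval v g)"
proof -
  obtain a c b a' c' b' where uv: "u = herm a c b" "v = herm a' c' b'"
    using hermitian u v by metis
  have dm: "u - v = herm (a - a') (c - c') (b - b')" and dp: "u + v = herm (a + a') (c + c') (b + b')"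
    unfolding uv by (rule mat2_eqI; simp)+
  have det: "det (g ** E) \<noteq> 0" if "g \<in> Delta_matrices m" for g
    using base det_Delta[OF that] by (simp add: det_mul)
  from disjoint[OF u v] show ?thesis
  proof
    assume "0 \<le> Re (det (u - v))"
    moreover have "u - v \<noteq> 0" using \<open>u \<noteq> v\<close> by simp
    ultimately show ?thesis
      using htrace_act_sign[OF dm] det unfolding wval_def htrace_act_diff by fastforce
  next
    assume "0 \<le> Re (det (u + v))"
    \<comment> \<open>Orientation excludes that both forms describe the same plane with opposite
      signs.\<close>
    moreover have "u + v \<noteq> 0" using oriented[OF v] u by (metis eq_neg_iff_add_eq_0)
    ultimately show ?thesis
      using htrace_act_sign[OF dp] det unfolding wval_def htrace_act_add by fastforce
  qed
qed

sublocale wall_action "Delta_SL m" "W0 \<union> W1" wval D herm_act wcol "{0, 1}"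
proof (rule wall_action.intro)
  have carrier: "carrier (Delta_SL m) = Delta_matrices m" by simp
  show "group (Delta_SL m)" by (rule group_Delta_SL)
  show "wall_space (W0 \<union> W1) (carrier (Delta_SL m)) wval D"
  proof
    show "wval v g \<noteq> 0" if "v \<in> W0 \<union> W1" "g \<in> carrier (Delta_SL m)" for v g
      using wval_in[of v g] D(1) that by fastforce
    show "wval v g \<in> D" if "v \<in> W0 \<union> W1" "g \<in> carrier (Delta_SL m)" for v g
      using wval_in that by simp
    show "finite (D \<inter> {- b..b})" for b by (rule D)
  qed (use wval_nested in \<open>simp only: carrier\<close>)
  show "wall_action_axioms (Delta_SL m) (W0 \<union> W1) wval herm_act wcol {0, 1}"
    using W0_act W1_act colours
    by unfold_locales (auto simp: herm_act_mult wval_def wcol_def simp flip: matrix_mul_assoc)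
qed

lemma retracts_onto_free:
  assumes "\<And>x. x \<in> {0, 1} \<Longrightarrow> \<exists>g\<in>Delta_matrices m. crossing g = [(x, True)]"
  shows "retracts_onto (Delta m) (free_group {0, 1 :: nat})"
proof -
  have "crossing (- A) = crossing A" if "A \<in> Delta_matrices m" for A
  proof (rule crossing_cong)
    have "- A ** E = - (A ** E)" by (rule mat2_eqI) (simp_all add: mat2_mult)
    thus "wval v (- A) = wval v A" for v by (simp add: wval_def herm_act_uminus)
  qed (use that Delta_matrices_uminus in simp_all)
  from Delta_hom_factor[OF crossing_hom this] obtain \<Phi> where
    "\<Phi> \<in> hom (Delta m) (free_group {0, 1})"
    "\<forall>A\<in>Delta_matrices m. \<exists>C\<in>carrier (Delta m). \<Phi> C = crossing A"
    by blast
  with assms show ?thesis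
    by (intro retracts_onto_free_groupI[OF group_Delta]) (assumption, metis)
qed

end

context wall_action
begin

lemma crossing_single:
  assumes "g \<in> carrier M" "separating \<one>\<^bsub>M\<^esub> g = {v}"
  shows "crossing g = [(col v, val v g > 0)]"
proof -
  have "walls_between \<one>\<^bsub>M\<^esub> g = [v]"
    using assms by (intro walls_between_eqI) (simp_all add: wall_list_def)
  thus ?thesis by (simp add: crossing_def crossing_word_def reduce_def reduced_mult_def)
qed

end

section \<open>Integer coordinates\<close>

text \<open>Also for \<open>m mod 4 = 3\<close> the entries of level 2 matrices have this form,
  because \<open>2 * quad_omega m = 1 + sqrt_neg m\<close>.\<close>

definition zq :: "nat \<Rightarrow> int \<Rightarrow> int \<Rightarrow> complex" where
  "zq m x y = of_int x + of_int y * sqrt_neg m"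

lemma Re_zq [simp]: "Re (zq m x y) = x" and Im_zq [simp]: "Im (zq m x y) = y * sqrt m"
  by (simp_all add: zq_def sqrt_neg_def)

lemma zq_eq_iff: "m > 0 \<Longrightarrow> zq m x y = zq m x' y' \<longleftrightarrow> x = x' \<and> y = y'"
  by (simp add: complex_eq_iff)

lemma zq_mult: "zq m x y * zq m x' y' = zq m (x * x' - int m * (y * y')) (x * y' + y * x')"
  by (simp add: complex_eq_iff algebra_simps)

lemma zq_add: "zq m x y + zq m x' y' = zq m (x + x') (y + y')"
  by (simp add: zq_def algebra_simps)

lemma zq_diff: "zq m x y - zq m x' y' = zq m (x - x') (y - y')"
  by (simp add: zq_def algebra_simps)

lemma cnj_zq: "cnj (zq m x y) = zq m x (- y)"
  by (simp add: complex_eq_iff)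

lemma cmod_zq: "(cmod (zq m x y))\<^sup>2 = of_int (x\<^sup>2 + int m * y\<^sup>2)"
  by (simp add: cmod_power2 power_mult_distrib)

lemma zq_0: "of_int x = zq m x 0"
  by (simp add: zq_def)

definition entries :: "nat \<Rightarrow> complex^2^2 \<Rightarrow> int \<Rightarrow> int \<Rightarrow> int \<Rightarrow> int \<Rightarrow> int \<Rightarrow> int \<Rightarrow> int \<Rightarrow> int \<Rightarrow> bool" where
  "entries m g x11 y11 x12 y12 x21 y21 x22 y22 \<longleftrightarrow>
    g $ 1 $ 1 = zq m x11 y11 \<and> g $ 1 $ 2 = zq m x12 y12 \<and>
    g $ 2 $ 1 = zq m x21 y21 \<and> g $ 2 $ 2 = zq m x22 y22 \<and>
    x11 * x22 - int m * (y11 * y22) - (x12 * x21 - int m * (y12 * y21)) = 1 \<and>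
    x11 * y22 + y11 * x22 - (x12 * y21 + y12 * x21) = 0"

lemma entriesI:
  assumes "m > 0" "det g = 1" "g $ 1 $ 1 = zq m x11 y11" "g $ 1 $ 2 = zq m x12 y12"
    "g $ 2 $ 1 = zq m x21 y21" "g $ 2 $ 2 = zq m x22 y22"
  shows "entries m g x11 y11 x12 y12 x21 y21 x22 y22"
proof -
  have "zq m x11 y11 * zq m x22 y22 - zq m x12 y12 * zq m x21 y21 = zq m 1 0"
    using assms by (simp add: det_2 flip: zq_0)
  thus ?thesis using assms by (simp add: zq_mult zq_diff zq_eq_iff entries_def)
qed

lemma Delta_entries_not_3:
  assumes "m > 0" "m mod 4 \<noteq> 3" "g \<in> Delta_matrices m"
  obtains x11 y11 x12 y12 x21 y21 x22 y22 where "entries m g x11 y11 x12 y12 x21 y21 x22 y22"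
    "odd x11" "even y11" "even x12" "even y12" "even x21" "even y21" "odd x22" "even y22"
proof -
  obtain a0 a1 b0 b1 c0 c1 d0 d1 where g: "g = level2_matrix m a0 a1 b0 b1 c0 c1 d0 d1"
    using assms(3) unfolding Delta_matrices_iff by blast
  have "entries m g (1 + 2 * a0) (2 * a1) (2 * b0) (2 * b1) (2 * c0) (2 * c1) (1 + 2 * d0) (2 * d1)"
    using assms by (intro entriesI det_Delta) (auto simp: g quad_omega_def zq_def algebra_simps)
  thus thesis by (rule that) simp_all
qed

text \<open>The defining congruence of \<open>b1\<close> and \<open>c1\<close> becomes the evenness
  of \<open>y12 + y21\<close>, on which the colouring depends.\<close>

lemma Delta_entries_3:
  assumes "m > 0" "m mod 4 = 3" "g \<in> Delta_matrices m"
  obtains x11 y11 x12 y12 x21 y21 x22 y22 where "entries m g x11 y11 x12 y12 x21 y21 x22 y22"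
    "odd (x11 + y11)" "even (x12 + y12)" "even (x21 + y21)" "odd (x22 + y22)" "even (y12 + y21)"
proof -
  obtain a0 a1 b0 b1 c0 c1 d0 d1 where g: "g = level2_matrix m a0 a1 b0 b1 c0 c1 d0 d1"
    and "[b1 = c1] (mod 2)"
    using assms(2,3) unfolding Delta_matrices_iff by blast
  hence "even (b1 + c1)" by (simp add: cong_iff_dvd_diff)
  moreover have "entries m g (1 + (2 * a0 + a1)) a1 (2 * b0 + b1) b1 (2 * c0 + c1) c1 (1 + (2 * d0 + d1)) d1"
    using assms by (intro entriesI det_Delta) (auto simp: g quad_omega_def zq_def field_simps)
  ultimately show thesis by (intro that[of "1 + (2 * a0 + a1)" a1 "2 * b0 + b1" b1 "2 * c0 + c1" c1 "1 + (2 * d0 + d1)" d1]) simp_all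
qed

lemma finite_odd_multiples:
  assumes "\<kappa> > 0"
  shows "finite ({\<kappa> * of_int k | k. odd k} \<inter> {- r..r :: real})"
proof (rule finite_subset)
  show "{\<kappa> * of_int k | k. odd k} \<inter> {- r..r} \<subseteq> (\<lambda>k. \<kappa> * of_int k) ` {- \<lceil>r / \<kappa>\<rceil>..\<lceil>r / \<kappa>\<rceil>}"
  proof
    fix d assume "d \<in> {\<kappa> * of_int k | k. odd k} \<inter> {- r..r}"
    then obtain k where d: "d = \<kappa> * of_int k" and "- r \<le> \<kappa> * of_int k" "\<kappa> * of_int k \<le> r" by auto
    hence "of_int k \<le> r / \<kappa>" "- of_int k \<le> r / \<kappa>" using assms by (simp_all add: field_simps)
    hence "k \<le> \<lceil>r / \<kappa>\<rceil>" "- k \<le> \<lceil>r / \<kappa>\<rceil>" by (simp_all add: le_ceiling_iff)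
    thus "d \<in> (\<lambda>k. \<kappa> * of_int k) ` {- \<lceil>r / \<kappa>\<rceil>..\<lceil>r / \<kappa>\<rceil>}" unfolding d by auto
  qed
qed simp

lemma odd_cases: "odd (B :: int) \<Longrightarrow> 1 \<le> B \<or> B \<le> - 1"
  by presburger


section \<open>The case \<open>m mod 4 \<noteq> 3\<close>\<close>

definition wall1 :: "nat \<Rightarrow> int \<Rightarrow> int \<Rightarrow> int \<Rightarrow> int \<Rightarrow> complex^2^2" where
  "wall1 m a c r s = herm (2 * a) (2 * c) (zq m r s)"

lemma wall1_eq_iff:
  "m > 0 \<Longrightarrow> wall1 m a c r s = wall1 m a' c' r' s' \<longleftrightarrow> a = a' \<and> c = c' \<and> r = r' \<and> s = s'"
  by (auto simp: wall1_def herm_eq_iff zq_eq_iff)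

lemma wall1_act:
  assumes "entries m g x11 y11 x12 y12 x21 y21 x22 y22"
  shows "herm_act (wall1 m a c r s) g = wall1 m
    (a * (x11\<^sup>2 + int m * y11\<^sup>2) + c * (x21\<^sup>2 + int m * y21\<^sup>2)
      + r * (x11 * x21 + int m * (y11 * y21)) - int m * s * (x11 * y21 - y11 * x21))
    (a * (x12\<^sup>2 + int m * y12\<^sup>2) + c * (x22\<^sup>2 + int m * y22\<^sup>2)
      + r * (x12 * x22 + int m * (y12 * y22)) - int m * s * (x12 * y22 - y12 * x22))
    (2 * a * (x11 * x12 + int m * (y11 * y12)) + 2 * c * (x21 * x22 + int m * (y21 * y22))
      + r * (x11 * x22 + int m * (y11 * y22) + x21 * x12 + int m * (y21 * y12))
      - int m * s * (x11 * y22 - y11 * x22 - (x21 * y12 - y21 * x12)))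
    (2 * a * (x11 * y12 - y11 * x12) + 2 * c * (x21 * y22 - y21 * x22)
      + r * (x11 * y22 - y11 * x22 + x21 * y12 - y21 * x12)
      + s * (x11 * x22 + int m * (y11 * y22) - (x21 * x12 + int m * (y21 * y12))))"
proof -
  have *: "complex_of_real (real_of_int (2 * k)) = zq m (2 * k) 0" for k by (simp add: zq_def)
  have "g $ 1 $ 1 = zq m x11 y11" "g $ 1 $ 2 = zq m x12 y12"
    "g $ 2 $ 1 = zq m x21 y21" "g $ 2 $ 2 = zq m x22 y22"
    using assms by (simp_all add: entries_def)
  thus ?thesis unfolding wall1_def herm_act_herm herm_eq_iff
    by (simp only: * cnj_zq zq_mult zq_add cmod_zq Re_zq)
      (auto intro!: arg_cong2[of _ _ _ _ "zq m"] simp: algebra_simps)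
qed

lemma det_wall1: "det (wall1 m a c r s) = of_int (4 * (a * c) - (r\<^sup>2 + int m * s\<^sup>2))"
  unfolding wall1_def det_herm cmod_zq by simp

text \<open>The norm equation makes the determinant -1, the congruence of \<open>r\<close> fixes the
  sign of the form, and \<open>P\<close> selects a colour. For \<open>s = 0\<close> these are, up to
  the factor 2, quadratic forms of discriminant 1, whose zeros are the ends of Farey lines.\<close>

definition walls1 :: "nat \<Rightarrow> (int \<Rightarrow> int \<Rightarrow> bool) \<Rightarrow> (complex^2^2) set" where
  "walls1 m P = {wall1 m a c r s | a c r s. P a c \<and> 4 dvd r - 1 \<and> 4 dvd s \<and>
     r\<^sup>2 + int m * s\<^sup>2 = 4 * (a * c) + 1}"

lemma walls1_act:
  assumes m: "m > 0" "m mod 4 \<noteq> 3" and g: "g \<in> Delta_matrices m" and v: "v \<in> walls1 m P"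
    and P: "\<And>a c a' c'. P a c \<Longrightarrow> even (a' - a) \<Longrightarrow> even (c' - c) \<Longrightarrow> P a' c'"
  shows "herm_act v g \<in> walls1 m P"
proof -
  obtain a c r s where ac: "P a c" and r: "4 dvd r - 1" and s: "4 dvd s"
    and norm: "r\<^sup>2 + int m * s\<^sup>2 = 4 * (a * c) + 1" and v: "v = wall1 m a c r s"
    using v unfolding walls1_def by blast
  obtain x11 y11 x12 y12 x21 y21 x22 y22 where e: "entries m g x11 y11 x12 y12 x21 y21 x22 y22"
    and par: "odd x11" "even y11" "even x12" "even y12" "even x21" "even y21" "odd x22" "even y22"
    using Delta_entries_not_3[OF m g] by blast
  from e have det1: "x11 * x22 - int m * (y11 * y22) - (x12 * x21 - int m * (y12 * y21)) = 1"
    and det0: "x11 * y22 + y11 * x22 - (x12 * y21 + y12 * x21) = 0" by (simp_all add: entries_def)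
  obtain a' c' r' s' where v': "herm_act v g = wall1 m a' c' r' s'"
    and a': "a' = a * (x11\<^sup>2 + int m * y11\<^sup>2) + c * (x21\<^sup>2 + int m * y21\<^sup>2)
      + r * (x11 * x21 + int m * (y11 * y21)) - int m * s * (x11 * y21 - y11 * x21)"
    and c': "c' = a * (x12\<^sup>2 + int m * y12\<^sup>2) + c * (x22\<^sup>2 + int m * y22\<^sup>2)
      + r * (x12 * x22 + int m * (y12 * y22)) - int m * s * (x12 * y22 - y12 * x22)"
    and r': "r' = 2 * a * (x11 * x12 + int m * (y11 * y12)) + 2 * c * (x21 * x22 + int m * (y21 * y22))
      + r * (x11 * x22 + int m * (y11 * y22) + x21 * x12 + int m * (y21 * y12))
      - int m * s * (x11 * y22 - y11 * x22 - (x21 * y12 - y21 * x12))"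
    and s': "s' = 2 * a * (x11 * y12 - y11 * x12) + 2 * c * (x21 * y22 - y21 * x22)
      + r * (x11 * y22 - y11 * x22 + x21 * y12 - y21 * x12)
      + s * (x11 * x22 + int m * (y11 * y22) - (x21 * x12 + int m * (y21 * y12)))"
    unfolding v wall1_act[OF e] by blast
  have "even (a' - a)" "even (c' - c)" unfolding a' c' using par by simp_all
  hence "P a' c'" using P ac by blast
  obtain p11 p12 p21 p22 where y: "y11 = 2 * p11" "y12 = 2 * p12" "y21 = 2 * p21" "y22 = 2 * p22"
    using par by (meson evenE)
  obtain q12 q21 where x: "x12 = 2 * q12" "x21 = 2 * q21" using par by (meson evenE)
  obtain \<rho> \<sigma> where \<rho>: "r = 1 + 4 * \<rho>" and \<sigma>: "s = 4 * \<sigma>"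
    using r s by (metis add.commute diff_add_cancel dvdE)
  \<comment> \<open>The real part of the determinant gives \<open>x11 * x22\<close> congruent to 1
    modulo 4. The imaginary part gives \<open>x11 * y22 + y11 * x22\<close> divisible by 4, hence
    also the difference, as \<open>y11\<close> is even.\<close>
  have xx: "x11 * x22 = 1 + 4 * (int m * (p11 * p22) + q12 * q21 - int m * (p12 * p21))"
    using det1 unfolding x y by (simp add: algebra_simps)
  have xy: "x11 * y22 - y11 * x22 = 4 * (q12 * p21 + p12 * q21 - p11 * x22)"
    using det0 unfolding x y by (simp add: algebra_simps)
  have "r' - 1 = 4 * (a * (x11 * q12 + 2 * int m * (p11 * p12)) + c * (q21 * x22 + 2 * int m * (p21 * p22))
      + \<rho> + r * (2 * int m * (p11 * p22) + 2 * (q12 * q21))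
      - int m * \<sigma> * (x11 * y22 - y11 * x22 - (x21 * y12 - y21 * x12)))"
    unfolding r' distrib_left[of r] xx unfolding x y \<rho> \<sigma> by (simp add: algebra_simps)
  hence "4 dvd r' - 1" by simp
  have "s' = 4 * (a * (x11 * p12 - 2 * (p11 * q12)) + c * (2 * (q21 * p22) - p21 * x22)
      + r * (q12 * p21 + p12 * q21 - p11 * x22 + q21 * p12 - p21 * q12)
      + \<sigma> * (x11 * x22 + int m * (y11 * y22) - (x21 * x12 + int m * (y21 * y12))))"
    unfolding s' xy unfolding x y \<sigma> by (simp add: algebra_simps)
  hence "4 dvd s'" by simp
  \<comment> \<open>The norm equation is transported as invariance of the determinant.\<close>
  have "det (wall1 m a' c' r' s') = det (wall1 m a c r s)"
    unfolding v'[symmetric] v by (rule det_herm_act) (rule det_Delta[OF g])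
  hence "4 * (a' * c') - (r'\<^sup>2 + int m * s'\<^sup>2) = 4 * (a * c) - (r\<^sup>2 + int m * s\<^sup>2)"
    unfolding det_wall1 by (simp only: of_int_eq_iff)
  hence "r'\<^sup>2 + int m * s'\<^sup>2 = 4 * (a' * c') + 1" using norm by simp
  thus ?thesis unfolding v' walls1_def using \<open>P a' c'\<close> \<open>4 dvd r' - 1\<close> \<open>4 dvd s'\<close> by blast
qed

lemma level2_in_Delta:
  fixes a0 a1 b0 b1 c0 c1 d0 d1 :: int
  assumes "(1 + 2 * (of_int a0 + of_int a1 * quad_omega m)) * (1 + 2 * (of_int d0 + of_int d1 * quad_omega m))
      - 2 * (of_int b0 + of_int b1 * quad_omega m) * (2 * (of_int c0 + of_int c1 * quad_omega m)) = 1"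
    and "even (b1 - c1)"
  shows "level2_matrix m a0 a1 b0 b1 c0 c1 d0 d1 \<in> Delta_matrices m"
proof -
  have "1 + 2 * (of_int p + of_int q * quad_omega m) \<in> bianchi_ring m"
    "2 * (of_int p + of_int q * quad_omega m) \<in> bianchi_ring m" for p q
    by (rule bianchi_ringI[of _ "1 + 2 * p" "2 * q"], simp add: algebra_simps)
      (rule bianchi_ringI[of _ "2 * p" "2 * q"], simp add: algebra_simps)
  moreover have "[b1 = c1] (mod 2)" using assms(2) by (simp add: cong_iff_dvd_diff)
  ultimately show ?thesis
    unfolding Delta_matrices_iff SL2_carrier_iff level2_matrix_nth using assms(1) by blast
qed

text \<open>\<open>B\<close> is the pairing of the two forms; their difference and sum have
  determinants \<open>2 * B - 2\<close> and \<open>- 2 * B - 2\<close>. The parities make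
  \<open>B\<close> odd, so it is not 0. The two cases take \<open>n = 1\<close> and
  \<open>n = m\<close>.\<close>

lemma disjoint_int:
  fixes n m a c r s a' c' r' s' :: int
  assumes "r\<^sup>2 + m * s\<^sup>2 = 4 * n * (a * c) + 1" "r'\<^sup>2 + m * s'\<^sup>2 = 4 * n * (a' * c') + 1"
    and "odd r" "odd r'" "even s"
  shows "0 \<le> 4 * n * ((a - a') * (c - c')) - ((r - r')\<^sup>2 + m * (s - s')\<^sup>2) \<or>
    0 \<le> 4 * n * ((a + a') * (c + c')) - ((r + r')\<^sup>2 + m * (s + s')\<^sup>2)"
proof -
  define B where "B = r * r' + m * (s * s') - 2 * n * (a * c' + a' * c)"
  have "odd B" unfolding B_def using assms by simp
  hence "1 \<le> B \<or> B \<le> - 1" by (rule odd_cases)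
  moreover have "4 * n * ((a - a') * (c - c')) - ((r - r')\<^sup>2 + m * (s - s')\<^sup>2) = 2 * B - 2"
    "4 * n * ((a + a') * (c + c')) - ((r + r')\<^sup>2 + m * (s + s')\<^sup>2) = - 2 * B - 2"
    using assms(1,2) unfolding B_def by (simp_all add: power2_eq_square algebra_simps)
  ultimately show ?thesis by linarith
qed

lemma norm_one_int:
  fixes k r s :: int
  assumes "r\<^sup>2 + k * s\<^sup>2 = 1" "k \<ge> 2"
  shows "s = 0 \<and> (r = 1 \<or> r = - 1)"
proof -
  have "s = 0"
  proof (rule ccontr)
    assume "s \<noteq> 0"
    hence "1 \<le> s\<^sup>2" by (simp add: int_one_le_iff_zero_less)
    hence "2 * 1 \<le> k * s\<^sup>2" using assms by (intro mult_mono) auto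
    thus False using assms zero_le_power2[of r] by linarith
  qed
  thus ?thesis using assms by (simp add: power2_eq_1_iff)
qed

text \<open>With \<open>p = a * c\<close>: the diagonal entries of a wall, its values at the cusps
  infinity and 0, never have opposite signs.\<close>

lemma norm_prod_nonneg:
  fixes k n r s p :: int
  assumes "r\<^sup>2 + k * s\<^sup>2 = 4 * n * p + 1" "k \<ge> 0" "n > 0" "r \<noteq> 0"
  shows "p \<ge> 0"
proof -
  have "1 \<le> r\<^sup>2" using assms by (simp add: int_one_le_iff_zero_less)
  moreover have "0 \<le> k * s\<^sup>2" using assms by simp
  ultimately have "0 \<le> 4 * n * p" using assms by linarith
  thus ?thesis using assms by (simp add: zero_le_mult_iff)
qed

text \<open>Translation by 2 fixes the cusp infinity and hence \<open>a\<close>. If \<open>a\<close>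
  were nonzero, the values at both points would have its sign. So \<open>a = 0\<close>, the norm
  equation gives \<open>r = 1\<close>, and \<open>c\<close> and \<open>c + 2\<close> have opposite
  signs.\<close>

lemma wall1_cross:
  fixes a c r s :: int
  assumes m: "m > 0" and r: "4 dvd r - 1" and s: "4 dvd s"
    and norm: "r\<^sup>2 + int m * s\<^sup>2 = 4 * (a * c) + 1"
    and cross: "(a + c) * (a + (c + 4 * a + 2 * r)) < 0"
  shows "a = 0 \<and> c = - 1 \<and> r = 1 \<and> s = 0"
proof -
  have "odd r" using r by presburger
  hence r0: "r \<noteq> 0" "r + 4 * a \<noteq> 0" by presburger+
  have p: "a * c \<ge> 0"
    by (rule norm_prod_nonneg[of r "int m" s 1]) (use norm r0 in simp_all)
  \<comment> \<open>The translated wall has off-diagonal coordinates \<open>r + 4 * a\<close> and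
    \<open>s\<close>.\<close>
  have p': "a * (c + 4 * a + 2 * r) \<ge> 0"
    by (rule norm_prod_nonneg[of "r + 4 * a" "int m" s 1])
      (use norm r0 in \<open>simp_all add: power2_eq_square algebra_simps\<close>)
  have a: "a = 0"
  proof (rule ccontr)
    assume "a \<noteq> 0"
    hence "0 < a * a" by (simp add: zero_less_mult_iff) linarith
    hence "0 < a * (a + c)" "0 < a * (a + (c + 4 * a + 2 * r))"
      using p p' by (simp_all only: distrib_left[of a a])
    hence "0 < (a * (a + c)) * (a * (a + (c + 4 * a + 2 * r)))" by (rule mult_pos_pos)
    also have "\<dots> = (a * a) * ((a + c) * (a + (c + 4 * a + 2 * r)))" by (simp add: algebra_simps)
    also have "\<dots> < 0" using \<open>0 < a * a\<close> cross by (rule mult_pos_neg)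
    finally show False .
  qed
  obtain \<sigma> where \<sigma>: "s = 4 * \<sigma>" using s by blast
  \<comment> \<open>Divisibility of \<open>s\<close> by 4 makes the coefficient
    \<open>16 * int m\<close> at least 2 even for \<open>m = 1\<close>.\<close>
  have "\<sigma> = 0 \<and> (r = 1 \<or> r = - 1)"
    by (rule norm_one_int[of r "16 * int m"]) (use norm m a \<sigma> in \<open>simp_all add: power_mult_distrib\<close>)
  moreover have "r \<noteq> - 1" using r by auto
  ultimately have "r = 1" "s = 0" using \<sigma> by auto
  moreover have "c = - 1" using cross a \<open>r = 1\<close> by (auto simp: mult_less_0_iff)
  ultimately show ?thesis using a by simp
qed

lemma wall1_diff: "wall1 m a c r s - wall1 m a' c' r' s' = wall1 m (a - a') (c - c') (r - r') (s - s')"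
  and wall1_add: "wall1 m a c r s + wall1 m a' c' r' s' = wall1 m (a + a') (c + c') (r + r') (s + s')"
  and wall1_uminus: "- wall1 m a c r s = wall1 m (- a) (- c) (- r) (- s)"
  unfolding wall1_def by (rule mat2_eqI; simp add: zq_def algebra_simps)+

text \<open>Walls with \<open>a\<close> and \<open>c\<close> both even are left out, among them
  \<open>wall1 m 0 0 1 0\<close>, which contains the base point. For the others \<open>a + c\<close>
  is odd, so the base value \<open>2 * (a + c)\<close> is nonzero.\<close>

lemma walls1_colours:
  "walls1 m (\<lambda>a c. even a \<and> odd c) \<union> walls1 m (\<lambda>a c. odd a \<and> even c) = walls1 m (\<lambda>a c. odd (a + c))"
proof -
  have "walls1 m P \<union> walls1 m Q = walls1 m (\<lambda>a c. P a c \<or> Q a c)" for P Q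
    unfolding walls1_def by blast
  moreover have "(\<lambda>a c. even a \<and> odd c \<or> odd a \<and> even c) = (\<lambda>a c :: int. odd (a + c))"
    by (intro ext) auto
  ultimately show ?thesis by simp
qed

lemma hermitian_walls_not_3:
  assumes m: "m > 0" "m mod 4 \<noteq> 3"
  shows "hermitian_walls m (walls1 m (\<lambda>a c. even a \<and> odd c)) (walls1 m (\<lambda>a c. odd a \<and> even c))
    (mat 1) {2 * of_int k | k. odd k}"
    (is "hermitian_walls m ?W0 ?W1 _ _")
proof
  note W = walls1_colours[of m]
  {
    fix v assume "v \<in> ?W0 \<union> ?W1"
    thus "\<exists>a c b. v = herm a c b" unfolding walls1_def wall1_def by blast
  next
    fix u v assume "u \<in> ?W0 \<union> ?W1" "v \<in> ?W0 \<union> ?W1"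
    then obtain a c r s a' c' r' s' where u: "u = wall1 m a c r s" and v: "v = wall1 m a' c' r' s'"
      and n: "r\<^sup>2 + int m * s\<^sup>2 = 4 * 1 * (a * c) + 1" "r'\<^sup>2 + int m * s'\<^sup>2 = 4 * 1 * (a' * c') + 1"
      and d: "4 dvd r - 1" "4 dvd r' - 1" "4 dvd s"
      unfolding W walls1_def by auto
    have "odd r" "odd r'" "even s" using d by presburger+
    from disjoint_int[OF n this] show "0 \<le> Re (det (u - v)) \<or> 0 \<le> Re (det (u + v))"
      unfolding u v wall1_diff wall1_add det_wall1
      by (simp only: mult_1_right complex_Re_of_int of_int_0_le_iff)
  next
    fix v assume "v \<in> ?W0 \<union> ?W1"
    then obtain a c r s where v: "v = wall1 m a c r s" and r: "4 dvd r - 1"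
      unfolding W walls1_def by auto
    show "- v \<notin> ?W0 \<union> ?W1"
    proof
      assume "- v \<in> ?W0 \<union> ?W1"
      hence "4 dvd - r - 1" unfolding W walls1_def v wall1_uminus by (auto simp: wall1_eq_iff[OF m(1)])
      with r show False by presburger
    qed
  next
    show "?W0 \<inter> ?W1 = {}" unfolding walls1_def by (auto simp: wall1_eq_iff[OF m(1)])
  next
    fix v g assume v: "v \<in> ?W0" and g: "g \<in> Delta_matrices m"
    show "herm_act v g \<in> ?W0" by (rule walls1_act[OF m g v]) auto
  next
    fix v g assume v: "v \<in> ?W1" and g: "g \<in> Delta_matrices m"
    show "herm_act v g \<in> ?W1" by (rule walls1_act[OF m g v]) auto
  next
    fix v assume "v \<in> ?W0 \<union> ?W1"
    then obtain a c r s where v: "v = wall1 m a c r s" and ac: "odd (a + c)"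
      unfolding W walls1_def by auto
    have "htrace (herm_act v (mat 1)) = 2 * of_int (a + c)" by (simp add: v wall1_def)
    thus "htrace (herm_act v (mat 1)) \<in> {2 * of_int k | k. odd k}" using ac by blast
  }
  show "det (mat 1 :: complex^2^2) \<noteq> 0" by simp
  show "0 \<notin> {2 * real_of_int k | k. odd k}" by auto
  show "finite ({2 * of_int k | k. odd k} \<inter> {- r..r :: real})" for r
    by (rule finite_odd_multiples) simp
qed

text \<open>The two elementary matrices with off-diagonal entry 2 each move the base point across a
  single wall, of colour 0 and 1 respectively.\<close>

lemma Delta_retracts_not_3:
  assumes m: "m > 0" "m mod 4 \<noteq> 3"
  shows "retracts_onto (Delta m) (free_group {0, 1 :: nat})"
proof -
  let ?W0 = "walls1 m (\<lambda>a c. even a \<and> odd c)" and ?W1 = "walls1 m (\<lambda>a c. odd a \<and> even c)"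
  interpret hermitian_walls m ?W0 ?W1 "mat 1" "{2 * of_int k | k. odd k}"
    by (rule hermitian_walls_not_3[OF m])
  note W = walls1_colours[of m]
  have val1: "wval (wall1 m a c r s) (mat 1) = 2 * of_int (a + c)" for a c r s
    by (simp add: wval_def wall1_def)
  let ?T = "level2_matrix m 0 0 1 0 0 0 0 0" and ?U = "level2_matrix m 0 0 0 0 1 0 0 0"
  have T: "?T \<in> Delta_matrices m" and U: "?U \<in> Delta_matrices m"
    by (rule level2_in_Delta; simp)+
  have eT: "entries m ?T 1 0 2 0 0 0 1 0" and eU: "entries m ?U 1 0 0 0 2 0 1 0"
    using m T U by (auto intro!: entriesI det_Delta simp: zq_def)
  have valT: "wval (wall1 m a c r s) ?T = 2 * of_int (a + (c + 4 * a + 2 * r))" for a c r s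
    by (simp add: wval_def wall1_act[OF eT]) (simp add: wall1_def)
  have valU: "wval (wall1 m a c r s) ?U = 2 * of_int (c + (a + 4 * c + 2 * r))" for a c r s
    by (simp add: wval_def wall1_act[OF eU]) (simp add: wall1_def)
  have less0: "2 * real_of_int x * (2 * real_of_int y) < 0 \<longleftrightarrow> x * y < 0" for x y
    by (simp add: mult_less_0_iff)
  have inT: "wall1 m 0 (- 1) 1 0 \<in> ?W0" and inU: "wall1 m (- 1) 0 1 0 \<in> ?W1"
    unfolding walls1_def by force+
  hence in': "wall1 m 0 (- 1) 1 0 \<in> walls1 m (\<lambda>a c. odd (a + c))"
    "wall1 m (- 1) 0 1 0 \<in> walls1 m (\<lambda>a c. odd (a + c))"
    unfolding W[symmetric] by blast+
  have sep: "separating x y = {v \<in> walls1 m (\<lambda>a c. odd (a + c)). wval v x * wval v y < 0}" for x y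
    unfolding separating_def unfolding W ..
  have "separating (mat 1) ?T = {wall1 m 0 (- 1) 1 0}"
  proof (intro equalityI subsetI)
    fix v assume "v \<in> separating (mat 1) ?T"
    then obtain a c r s where v: "v = wall1 m a c r s" and r: "4 dvd r - 1" "4 dvd s"
      and n: "r\<^sup>2 + int m * s\<^sup>2 = 4 * (a * c) + 1" and x: "(a + c) * (a + (c + 4 * a + 2 * r)) < 0"
      unfolding sep unfolding walls1_def by (auto simp only: val1 valT less0 mem_Collect_eq)
    show "v \<in> {wall1 m 0 (- 1) 1 0}" using wall1_cross[OF m(1) r n x] v by simp
  qed (use in' in \<open>auto simp only: sep val1 valT mem_Collect_eq singleton_iff less0\<close>, simp)
  hence T0: "crossing ?T = [(0, True)]"
    using crossing_single[of ?T] T inT by (simp add: valT wcol_def)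
  have "separating (mat 1) ?U = {wall1 m (- 1) 0 1 0}"
  proof (intro equalityI subsetI)
    fix v assume "v \<in> separating (mat 1) ?U"
    then obtain a c r s where v: "v = wall1 m a c r s" and r: "4 dvd r - 1" "4 dvd s"
      and n: "r\<^sup>2 + int m * s\<^sup>2 = 4 * (a * c) + 1" and x: "(a + c) * (c + (a + 4 * c + 2 * r)) < 0"
      unfolding sep unfolding walls1_def by (auto simp only: val1 valU less0 mem_Collect_eq)
    \<comment> \<open>Exchanging \<open>a\<close> and \<open>c\<close> reduces \<open>?U\<close> to
      the computation for \<open>?T\<close>.\<close>
    show "v \<in> {wall1 m (- 1) 0 1 0}"
      using wall1_cross[OF m(1) r, of c a] n x v by (simp add: add.commute mult.commute)
  qed (use in' in \<open>auto simp only: sep val1 valU mem_Collect_eq singleton_iff less0\<close>, simp)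
  hence U1: "crossing ?U = [(1, True)]"
    using crossing_single[of ?U] U inU colours by (auto simp: valU wcol_def)
  show ?thesis by (rule retracts_onto_free) (use T U T0 U1 in auto)
qed

section \<open>The case \<open>m mod 4 = 3\<close>\<close>

text \<open>
  These are the walls \<open>\<i> K\<close> for the skew-Hermitian matrices \<open>K\<close> with diagonal \<open>2 a sqrt_neg m\<close>,
  \<open>2 c sqrt_neg m\<close> and upper right entry \<open>r + s sqrt_neg m\<close>; for \<open>(a, c, r, s) = (0, 0, 1, 0)\<close>
  the wall is the hyperbolic plane preserved by \<open>SL(2, \<int>)\<close>.
\<close>

definition wall2 :: "nat \<Rightarrow> int \<Rightarrow> int \<Rightarrow> int \<Rightarrow> int \<Rightarrow> complex^2^2" where
  "wall2 m a c r s = herm (- (2 * a * sqrt m)) (- (2 * c * sqrt m)) (\<i> * zq m r s)"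

lemma wall2_eq_iff:
  "m > 0 \<Longrightarrow> wall2 m a c r s = wall2 m a' c' r' s' \<longleftrightarrow> a = a' \<and> c = c' \<and> r = r' \<and> s = s'"
  by (auto simp: wall2_def herm_eq_iff zq_eq_iff)

lemma det_wall2: "det (wall2 m a c r s) = of_int (4 * int m * (a * c) - (r\<^sup>2 + int m * s\<^sup>2))"
proof -
  have "- (2 * real_of_int a * sqrt m) * - (2 * real_of_int c * sqrt m) = 4 * (sqrt m * sqrt m) * (a * c)"
    by (simp add: algebra_simps)
  also have "\<dots> = of_int (4 * int m * (a * c))" by simp
  finally show ?thesis 
    unfolding wall2_def det_herm norm_mult norm_ii mult_1 cmod_zq by (simp only: of_int_diff of_real_diff of_real_of_int_eq)
qed

lemma Re_ii_zq: "Re (\<i> * zq m x y) = - y * sqrt m"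
  by simp

lemma of_real_ii_zq: "complex_of_real (- (2 * real_of_int a * sqrt m)) = \<i> * zq m 0 (2 * a)"
  by (simp add: complex_eq_iff)

lemma wall2_act:
  assumes "entries m g x11 y11 x12 y12 x21 y21 x22 y22"
  shows "herm_act (wall2 m a c r s) g = wall2 m
    (a * (x11\<^sup>2 + int m * y11\<^sup>2) + c * (x21\<^sup>2 + int m * y21\<^sup>2)
      + r * (x11 * y21 - y11 * x21) + s * (x11 * x21 + int m * (y11 * y21)))
    (a * (x12\<^sup>2 + int m * y12\<^sup>2) + c * (x22\<^sup>2 + int m * y22\<^sup>2)
      + r * (x12 * y22 - y12 * x22) + s * (x12 * x22 + int m * (y12 * y22)))
    (r * (x11 * x22 + int m * (y11 * y22) - (x21 * x12 + int m * (y21 * y12)))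
      - int m * (2 * a * (x11 * y12 - y11 * x12) + 2 * c * (x21 * y22 - y21 * x22)
        + s * (x11 * y22 - y11 * x22 + (x21 * y12 - y21 * x12))))
    (2 * a * (x11 * x12 + int m * (y11 * y12)) + 2 * c * (x21 * x22 + int m * (y21 * y22))
      + r * (x11 * y22 - y11 * x22 - (x21 * y12 - y21 * x12))
      + s * (x11 * x22 + int m * (y11 * y22) + (x21 * x12 + int m * (y21 * y12))))"
proof -
  have g: "g $ 1 $ 1 = zq m x11 y11" "g $ 1 $ 2 = zq m x12 y12"
    "g $ 2 $ 1 = zq m x21 y21" "g $ 2 $ 2 = zq m x22 y22"
    using assms by (simp_all add: entries_def)
  have cnj: "cnj (\<i> * zq m r s) = \<i> * zq m (- r) s"
    by (simp add: complex_eq_iff)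
  show ?thesis unfolding wall2_def herm_act_herm herm_eq_iff g of_real_ii_zq cnj
  proof (intro conjI)
    show "\<i> * zq m 0 (2 * a) * cnj (zq m x11 y11) * zq m x12 y12 + \<i> * zq m r s * cnj (zq m x11 y11) * zq m x22 y22 +
      \<i> * zq m (- r) s * cnj (zq m x21 y21) * zq m x12 y12 + \<i> * zq m 0 (2 * c) * cnj (zq m x21 y21) * zq m x22 y22 =
      \<i> * zq m (r * (x11 * x22 + int m * (y11 * y22) - (x21 * x12 + int m * (y21 * y12)))
      - int m * (2 * a * (x11 * y12 - y11 * x12) + 2 * c * (x21 * y22 - y21 * x22)
        + s * (x11 * y22 - y11 * x22 + (x21 * y12 - y21 * x12))))
      (2 * a * (x11 * x12 + int m * (y11 * y12)) + 2 * c * (x21 * x22 + int m * (y21 * y22))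
      + r * (x11 * y22 - y11 * x22 - (x21 * y12 - y21 * x12))
      + s * (x11 * x22 + int m * (y11 * y22) + (x21 * x12 + int m * (y21 * y12))))"
      unfolding mult.assoc distrib_left[of \<i>, symmetric] cnj_zq zq_mult zq_add
      by (intro arg_cong2[of _ _ _ _ "zq m"] arg_cong[of _ _ "(*) \<i>"]) (simp_all add: algebra_simps)
  qed (simp_all only: mult.assoc cnj_zq zq_mult Re_ii_zq cmod_zq, simp_all add: algebra_simps)
qed

text \<open>The determinant is again -1. The congruence of \<open>r\<close> modulo \<open>m\<close>
  orients the form; the colour is the parity of \<open>a + c\<close>.\<close>

definition walls2 :: "nat \<Rightarrow> (int \<Rightarrow> bool) \<Rightarrow> (complex^2^2) set" where
  "walls2 m P = {wall2 m a c r s | a c r s. P (a + c) \<and> odd r \<and> even s \<and> int m dvd r - 1 \<and>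
     r\<^sup>2 + int m * s\<^sup>2 = 4 * int m * (a * c) + 1}"

lemma walls2_act:
  assumes m: "m > 0" "m mod 4 = 3" and g: "g \<in> Delta_matrices m" and v: "v \<in> walls2 m P"
    and P: "\<And>k k'. P k \<Longrightarrow> even (k' - k) \<Longrightarrow> P k'"
  shows "herm_act v g \<in> walls2 m P"
proof -
  obtain a c r s where ac: "P (a + c)" and r: "odd r" "int m dvd r - 1" and s: "even s"
    and norm: "r\<^sup>2 + int m * s\<^sup>2 = 4 * int m * (a * c) + 1" and v: "v = wall2 m a c r s"
    using v unfolding walls2_def by blast
  obtain x11 y11 x12 y12 x21 y21 x22 y22 where e: "entries m g x11 y11 x12 y12 x21 y21 x22 y22"
    and par: "odd (x11 + y11)" "even (x12 + y12)" "even (x21 + y21)" "odd (x22 + y22)" "even (y12 + y21)"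
    using Delta_entries_3[OF m g] by blast
  from e have det1: "x11 * x22 - int m * (y11 * y22) - (x12 * x21 - int m * (y12 * y21)) = 1"
    and det0: "x11 * y22 + y11 * x22 - (x12 * y21 + y12 * x21) = 0" by (simp_all add: entries_def)
  obtain a' c' r' s' where v': "herm_act v g = wall2 m a' c' r' s'"
    and a': "a' = a * (x11\<^sup>2 + int m * y11\<^sup>2) + c * (x21\<^sup>2 + int m * y21\<^sup>2)
      + r * (x11 * y21 - y11 * x21) + s * (x11 * x21 + int m * (y11 * y21))"
    and c': "c' = a * (x12\<^sup>2 + int m * y12\<^sup>2) + c * (x22\<^sup>2 + int m * y22\<^sup>2)
      + r * (x12 * y22 - y12 * x22) + s * (x12 * x22 + int m * (y12 * y22))"
    and r': "r' = r * (x11 * x22 + int m * (y11 * y22) - (x21 * x12 + int m * (y21 * y12)))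
      - int m * (2 * a * (x11 * y12 - y11 * x12) + 2 * c * (x21 * y22 - y21 * x22)
        + s * (x11 * y22 - y11 * x22 + (x21 * y12 - y21 * x12)))"
    and s': "s' = 2 * a * (x11 * x12 + int m * (y11 * y12)) + 2 * c * (x21 * x22 + int m * (y21 * y22))
      + r * (x11 * y22 - y11 * x22 - (x21 * y12 - y21 * x12))
      + s * (x11 * x22 + int m * (y11 * y22) + (x21 * x12 + int m * (y21 * y12)))"
    unfolding v wall2_act[OF e] by blast
  have "odd m" using m by presburger
  \<comment> \<open>Modulo 2 the diagonal entries change by \<open>y21\<close> and
    \<open>y12\<close>. Their sum is even by the condition that cuts out \<open>Delta\<close>, so
    the colour is invariant.\<close>
  have "even (a' - (a + y21))"
    unfolding a' using par \<open>odd m\<close> r s by (cases "even y11"; cases "even y21") auto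
  moreover have "even (c' - (c + y12))"
    unfolding c' using par \<open>odd m\<close> r s by (cases "even y12"; cases "even y22") auto
  moreover have "(a' + c') - (a + c) = (a' - (a + y21)) + (c' - (c + y12)) + (y12 + y21)" by simp
  ultimately have "even ((a' + c') - (a + c))" using par(5) by presburger
  hence "P (a' + c')" using P ac by blast
  \<comment> \<open>The real part of the determinant gives \<open>r'\<close> congruent to
    \<open>r\<close> modulo \<open>2 * int m\<close>; the imaginary part makes the contribution of
    \<open>r\<close> to \<open>s'\<close> even.\<close>
  have det1': "x11 * x22 - x21 * x12 = 1 + int m * (y11 * y22 - y12 * y21)"
    and det0': "x11 * y22 - y11 * x22 - (x21 * y12 - y21 * x12) = 2 * (x12 * y21 - y11 * x22)"
    using det1 det0 by (simp_all add: algebra_simps)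
  have "r' = r * ((x11 * x22 - x21 * x12) + int m * (y11 * y22 - y21 * y12))
      - int m * (2 * a * (x11 * y12 - y11 * x12) + 2 * c * (x21 * y22 - y21 * x22)
        + s * (x11 * y22 - y11 * x22 + (x21 * y12 - y21 * x12)))"
    unfolding r' by (simp add: algebra_simps)
  also have "\<dots> = r + int m * (2 * (r * (y11 * y22 - y12 * y21)) -
      (2 * a * (x11 * y12 - y11 * x12) + 2 * c * (x21 * y22 - y21 * x22)
        + s * (x11 * y22 - y11 * x22 + (x21 * y12 - y21 * x12))))"
    unfolding det1' by (simp add: algebra_simps)
  finally obtain k where k: "r' = r + int m * k" and "even k" using s by force
  have "odd r'" using k \<open>even k\<close> r by simp
  have "r' - 1 = (r - 1) + int m * k" using k by simp
  hence "int m dvd r' - 1" using r(2) by (metis dvd_add dvd_triv_left)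
  have "even s'" unfolding s' det0' using s by simp
  have "det (wall2 m a' c' r' s') = det (wall2 m a c r s)"
    unfolding v'[symmetric] v by (rule det_herm_act) (rule det_Delta[OF g])
  hence "4 * int m * (a' * c') - (r'\<^sup>2 + int m * s'\<^sup>2) = 4 * int m * (a * c) - (r\<^sup>2 + int m * s\<^sup>2)"
    unfolding det_wall2 by (simp only: of_int_eq_iff)
  hence "r'\<^sup>2 + int m * s'\<^sup>2 = 4 * int m * (a' * c') + 1" using norm by simp
  thus ?thesis unfolding v' walls2_def
    using \<open>P (a' + c')\<close> \<open>odd r'\<close> \<open>even s'\<close> \<open>int m dvd r' - 1\<close> by blast
qed

lemma quarter: "m mod 4 = 3 \<Longrightarrow> 4 * ((int m + 1) div 4) = int m + 1"
  by presburger

text \<open>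
  The columns of this matrix determine the base point over \<open>sqrt_neg m / 2\<close> at height \<open>1 / 2\<close>. It is
  on no wall, as the values at it turn out to be odd multiples of \<open>sqrt m\<close>.
\<close>

definition base2 :: "nat \<Rightarrow> complex^2^2" where
  "base2 m = vector [vector [zq m 0 1 / 2, 1 / 2], vector [1, 0]]"

lemma htrace_wall2:
  assumes "m mod 4 = 3"
  shows "htrace (herm_act (wall2 m a c r s) (base2 m)) =
    sqrt m * of_int (r - 2 * a * ((int m + 1) div 4) - 2 * c)"
proof -
  \<comment> \<open>The squared absolute values in the first row of \<open>base2 m\<close> add up to
    the integer \<open>(m + 1) / 4\<close>.\<close>
  have n: "real m + 1 = 4 * of_int ((int m + 1) div 4)"
    using quarter[OF assms] by linarith
  have E: "base2 m $ 1 $ 1 = zq m 0 1 / 2" "base2 m $ 1 $ 2 = 1 / 2" "base2 m $ 2 $ 1 = 1" "base2 m $ 2 $ 2 = 0"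
    by (simp_all add: base2_def)
  have "htrace (herm_act (wall2 m a c r s) (base2 m)) =
    - (2 * a * sqrt m) * ((real m + 1) / 4) - 2 * c * sqrt m + r * sqrt m"
    unfolding wall2_def herm_act_herm htrace_herm E
    by (simp add: norm_divide power_divide cmod_zq field_simps)
  also have "\<dots> = sqrt m * of_int (r - 2 * a * ((int m + 1) div 4) - 2 * c)"
    unfolding n by (simp add: algebra_simps)
  finally show ?thesis .
qed

text \<open>The norm equation when \<open>a * c = 0\<close>. The congruence excludes
  \<open>r = - 1\<close> because \<open>m\<close> is at least 3.\<close>

lemma wall2_unit:
  fixes r s :: int
  assumes m: "m mod 4 = 3" and "int m dvd r - 1" "r\<^sup>2 + int m * s\<^sup>2 = 1"
  shows "r = 1 \<and> s = 0"
proof -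
  have m3: "m \<ge> 3" using m by presburger
  have "s = 0 \<and> (r = 1 \<or> r = - 1)" using norm_one_int[OF assms(3)] m3 by simp
  moreover have "r \<noteq> - 1"
  proof
    assume "r = - 1"
    hence "int m dvd 2" using assms(2) by (simp add: dvd_minus_iff[of _ 2, symmetric] del: dvd_minus_iff)
    thus False using m3 zdvd_imp_le by fastforce
  qed
  ultimately show ?thesis by simp
qed

text \<open>The diagonal part dominates: for \<open>a * c > 0\<close> the norm equation and the
  inequality of the means give \<open>\<bar>r\<bar> < \<bar>2 * a * n + 2 * c\<bar>\<close>, and for
  \<open>a * c = 0\<close> one has \<open>r = 1\<close>. So the side of the base point can be read
  off the signs of \<open>a\<close> and \<open>c\<close>.\<close>

lemma wall2_sign:
  fixes a c r s :: int
  assumes m: "m mod 4 = 3" and n: "4 * n = int m + 1" and r: "odd r" "int m dvd r - 1"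
    and norm: "r\<^sup>2 + int m * s\<^sup>2 = 4 * int m * (a * c) + 1"
  shows "r - 2 * a * n - 2 * c \<noteq> 0" and "0 < r - 2 * a * n - 2 * c \<longleftrightarrow> a \<le> 0 \<and> c \<le> 0"
    and "a * c \<ge> 0"
proof -
  have "odd (r - 2 * a * n - 2 * c)" using r by simp
  thus "r - 2 * a * n - 2 * c \<noteq> 0" by (metis even_zero)
  have n1: "n \<ge> 1" using n m by presburger
  have m0: "int m > 0" using m by presburger
  have "r \<noteq> 0" using r by auto
  show ac: "a * c \<ge> 0"
    by (rule norm_prod_nonneg[of r "int m" s "int m"]) (use norm \<open>r \<noteq> 0\<close> m0 in simp_all)
  show "0 < r - 2 * a * n - 2 * c \<longleftrightarrow> a \<le> 0 \<and> c \<le> 0"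
  proof (cases "a * c = 0")
    case True
    hence "r = 1" using wall2_unit[OF m r(2)] norm by auto
    moreover from True have "a = 0 \<or> c = 0" by simp
    moreover have "0 < 1 - 2 * a * n \<longleftrightarrow> a \<le> 0"
    proof -
      have "a \<ge> 1 \<Longrightarrow> a * n \<ge> 1" using n1 mult_mono[of 1 a 1 n] by simp
      moreover have "a \<le> 0 \<Longrightarrow> a * n \<le> 0" using n1 by (simp add: mult_nonpos_nonneg)
      ultimately show ?thesis by linarith
    qed
    ultimately show ?thesis by auto
  next
    case False
    hence "a * c \<ge> 1" using ac by linarith
    have "r\<^sup>2 \<le> 4 * int m * (a * c) + 1" using norm m0 by (metis zero_le_power2 le_add_same_cancel1 mult_nonneg_nonneg order_less_imp_le)
    also have "\<dots> < 4 * (4 * n) * (a * c)" unfolding n using \<open>a * c \<ge> 1\<close> by (simp add: algebra_simps)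
    also have "\<dots> = (2 * a * n + 2 * c)\<^sup>2 - (2 * a * n - 2 * c)\<^sup>2" by (simp add: power2_eq_square algebra_simps)
    also have "\<dots> \<le> (2 * a * n + 2 * c)\<^sup>2" by simp
    finally have "\<bar>r\<bar> < \<bar>2 * a * n + 2 * c\<bar>" by (meson abs_le_square_iff linorder_not_le)
    moreover have "a > 0 \<and> c > 0 \<or> a < 0 \<and> c < 0" using ac False by (auto simp: zero_le_mult_iff)
    moreover have "a > 0 \<Longrightarrow> a * n > 0" "a < 0 \<Longrightarrow> a * n < 0" using n1 by (simp_all add: mult_neg_pos)
    ultimately show ?thesis by (auto simp: mult.assoc)
  qed
qed


lemma wall2_diff: "wall2 m a c r s - wall2 m a' c' r' s' = wall2 m (a - a') (c - c') (r - r') (s - s')"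
  and wall2_add: "wall2 m a c r s + wall2 m a' c' r' s' = wall2 m (a + a') (c + c') (r + r') (s + s')"
  and wall2_uminus: "- wall2 m a c r s = wall2 m (- a) (- c) (- r) (- s)"
  unfolding wall2_def by (rule mat2_eqI; simp add: zq_def algebra_simps)+

lemma walls2_colours: "walls2 m even \<union> walls2 m odd = walls2 m (\<lambda>_. True)"
  unfolding walls2_def by blast

lemma hermitian_walls_3:
  assumes m: "m mod 4 = 3"
  shows "hermitian_walls m (walls2 m even) (walls2 m odd) (base2 m) {sqrt m * of_int k | k. odd k}"
proof
  have m0: "m > 0" and m3: "m \<ge> 3" using m by presburger+
  note W = walls2_colours[of m]
  {
    fix v assume "v \<in> walls2 m even \<union> walls2 m odd"
    thus "\<exists>a c b. v = herm a c b" unfolding walls2_def wall2_def by blast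
  next
    fix u v assume "u \<in> walls2 m even \<union> walls2 m odd" "v \<in> walls2 m even \<union> walls2 m odd"
    then obtain a c r s a' c' r' s' where u: "u = wall2 m a c r s" and v: "v = wall2 m a' c' r' s'"
      and n: "r\<^sup>2 + int m * s\<^sup>2 = 4 * int m * (a * c) + 1" "r'\<^sup>2 + int m * s'\<^sup>2 = 4 * int m * (a' * c') + 1"
      and d: "odd r" "odd r'" "even s"
      unfolding W unfolding walls2_def by blast
    from disjoint_int[OF n d] show "0 \<le> Re (det (u - v)) \<or> 0 \<le> Re (det (u + v))"
      unfolding u v wall2_diff wall2_add det_wall2 by (simp only: complex_Re_of_int of_int_0_le_iff)
  next
    fix v assume "v \<in> walls2 m even \<union> walls2 m odd"
    then obtain a c r s where v: "v = wall2 m a c r s" and r: "int m dvd r - 1"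
      unfolding W unfolding walls2_def by blast
    show "- v \<notin> walls2 m even \<union> walls2 m odd"
    proof
      assume "- v \<in> walls2 m even \<union> walls2 m odd"
      hence "int m dvd - r - 1" unfolding W v wall2_uminus unfolding walls2_def by (auto simp: wall2_eq_iff[OF m0])
      \<comment> \<open>The two congruences add up to divisibility of -2 by
        \<open>m\<close>.\<close>
      from dvd_add[OF r this] have "int m dvd 2" by simp
      thus False using m3 zdvd_imp_le by fastforce
    qed
  next
    show "walls2 m even \<inter> walls2 m odd = {}" unfolding walls2_def by (auto simp: wall2_eq_iff[OF m0])
  next
    fix v g assume v: "v \<in> walls2 m even" and g: "g \<in> Delta_matrices m"
    show "herm_act v g \<in> walls2 m even" by (rule walls2_act[OF m0 m g v]) auto
  next
    fix v g assume v: "v \<in> walls2 m odd" and g: "g \<in> Delta_matrices m"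
    show "herm_act v g \<in> walls2 m odd" by (rule walls2_act[OF m0 m g v]) auto
  next
    fix v assume "v \<in> walls2 m even \<union> walls2 m odd"
    then obtain a c r s where v: "v = wall2 m a c r s" and r: "odd r"
      unfolding W unfolding walls2_def by blast
    have "odd (r - 2 * a * ((int m + 1) div 4) - 2 * c)" using r by simp
    thus "htrace (herm_act v (base2 m)) \<in> {sqrt m * of_int k | k. odd k}"
      unfolding v htrace_wall2[OF m] by blast
  }
  show "det (base2 m) \<noteq> 0" by (simp add: det_2 base2_def)
  show "0 \<notin> {sqrt m * real_of_int k | k. odd k}" using m0 by auto
  show "finite ({sqrt m * of_int k | k. odd k} \<inter> {- r..r :: real})" for r
    by (rule finite_odd_multiples) (use m0 in simp)
qed

text \<open>
  Here \<open>a + c + s\<close> is, up to scaling, the value of the form at the vector \<open>(1, 1)\<close>, which is fixed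
  by the parabolic matrix whose action is considered.
\<close>

lemma wall2_cross_h:
  fixes a c r s :: int
  assumes m: "m mod 4 = 3" and r: "odd r" "int m dvd r - 1"
    and norm: "r\<^sup>2 + int m * s\<^sup>2 = 4 * int m * (a * c) + 1"
    and a': "a' = a * (4 + int m) + c * (1 + int m) + r + s * (2 + int m)"
    and r': "odd r'" "int m dvd r' - 1"
    and norm': "r'\<^sup>2 + int m * s'\<^sup>2 = 4 * int m * (a' * c') + 1"
    and s': "a' + c' + s' = a + c + s"
    and cross: "(a \<le> 0 \<and> c \<le> 0) \<noteq> (a' \<le> 0 \<and> c' \<le> 0)"
  shows "a = 0 \<and> c = 0 \<and> r = 1 \<and> s = 0"
proof -
  note n = quarter[OF m]
  \<comment> \<open>In the basis (1, 0), (1, 1) the entry \<open>y\<close> becomes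
    \<open>x + y + q\<close> and \<open>q\<close> becomes \<open>q + 2 * x\<close>, with the same
    norm equation; the criterion for the side is unchanged.\<close>
  have shift: "x * (x + y + q) \<ge> 0 \<and> (x \<le> 0 \<and> y \<le> 0 \<longleftrightarrow> x \<le> 0 \<and> x + y + q \<le> 0)"
    if "odd p" "int m dvd p - 1" and N: "p\<^sup>2 + int m * q\<^sup>2 = 4 * int m * (x * y) + 1" for x y p q :: int
  proof -
    have N': "p\<^sup>2 + int m * (q + 2 * x)\<^sup>2 = 4 * int m * (x * (x + y + q)) + 1"
      using N by (simp add: power2_eq_square algebra_simps)
    have xy: "x * y \<ge> 0" by (rule wall2_sign(3)[OF m n that])
    have xz: "x * (x + y + q) \<ge> 0" by (rule wall2_sign(3)[OF m n that(1,2) N'])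
    have "q = 0" if "x = 0" using wall2_unit[OF m \<open>int m dvd p - 1\<close>, of q] N that by simp
    thus ?thesis using xy xz by (auto simp: zero_le_mult_iff)
  qed
  have F: "a * (a + c + s) \<ge> 0" "a' * (a + c + s) \<ge> 0"
    "(a \<le> 0 \<and> a + c + s \<le> 0) \<noteq> (a' \<le> 0 \<and> a + c + s \<le> 0)"
    using shift[OF r norm] shift[OF r' norm'] cross unfolding s' by auto
  \<comment> \<open>Otherwise this common value would determine the side both before and after the
    move.\<close>
  hence F0: "a + c + s = 0" by (auto simp: zero_le_mult_iff)
  have "r\<^sup>2 + int m * (s + 2 * a)\<^sup>2 = 4 * int m * (a * (a + c + s)) + 1"
    using norm by (simp add: power2_eq_square algebra_simps)
  hence "r = 1 \<and> s + 2 * a = 0" using wall2_unit[OF m r(2)] F0 by simp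
  hence rs: "r = 1" "s = - 2 * a" "c = a" using F0 by simp_all
  hence "a' = a + 1" unfolding a' by (simp add: algebra_simps)
  hence "a = 0" using F(3) F0 by auto
  thus ?thesis using rs by simp
qed

text \<open>The translation fixes the cusp infinity, so a nonzero \<open>a\<close> determines both
  sides. With \<open>a = 0\<close> and \<open>r = 1\<close> it acts as \<open>c' = c - 2\<close>,
  which leaves two walls.\<close>

lemma wall2_cross_t:
  fixes a c r s :: int
  assumes m: "m mod 4 = 3" and r: "odd r" "int m dvd r - 1"
    and norm: "r\<^sup>2 + int m * s\<^sup>2 = 4 * int m * (a * c) + 1"
    and c': "c' = a * (4 * int m) + c - 2 * r"
    and ac': "a * c' \<ge> 0"
    and cross: "(a \<le> 0 \<and> c \<le> 0) \<noteq> (a \<le> 0 \<and> c' \<le> 0)"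
  shows "a = 0 \<and> (c = 1 \<or> c = 2) \<and> r = 1 \<and> s = 0"
proof -
  note n = quarter[OF m]
  have "a * c \<ge> 0" by (rule wall2_sign(3)[OF m n r norm])
  hence a: "a = 0" using ac' cross by (auto simp: zero_le_mult_iff)
  hence "r = 1 \<and> s = 0" using wall2_unit[OF m r(2)] norm by simp
  thus ?thesis using cross a unfolding c' by auto
qed


lemma Delta_retracts_3:
  assumes m: "m mod 4 = 3"
  shows "retracts_onto (Delta m) (free_group {0, 1 :: nat})"
proof -
  interpret hermitian_walls m "walls2 m even" "walls2 m odd" "base2 m" "{sqrt m * of_int k | k. odd k}"
    by (rule hermitian_walls_3[OF m])
  have m0: "m > 0" using m by presburger
  define \<nu> where "\<nu> = (int m + 1) div 4"
  have \<nu>: "4 * \<nu> = int m + 1" unfolding \<nu>_def by (rule quarter[OF m])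
  \<comment> \<open>\<open>L\<close> is the value at the base point divided by
    \<open>sqrt m\<close>; \<open>Q\<close> collects the conditions on a wall apart from its
    colour.\<close>
  define L where "L a c r = r - 2 * a * \<nu> - 2 * c" for a c r :: int
  define Q where "Q a c r s \<longleftrightarrow> odd r \<and> even s \<and> int m dvd r - 1 \<and>
    r\<^sup>2 + int m * s\<^sup>2 = 4 * int m * (a * c) + 1" for a c r s :: int
  have W: "walls2 m even \<union> walls2 m odd = {wall2 m a c r s | a c r s. Q a c r s}"
    unfolding walls2_colours unfolding walls2_def Q_def by simp
  have Q_act: "Q a' c' r' s'"
    if "g \<in> Delta_matrices m" "Q a c r s" "herm_act (wall2 m a c r s) g = wall2 m a' c' r' s'"
    for g a c r s a' c' r' s'
  proof -
    have "wall2 m a c r s \<in> walls2 m even \<union> walls2 m odd" unfolding W using that by blast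
    hence "wall2 m a' c' r' s' \<in> walls2 m even \<union> walls2 m odd"
      using W0_act[OF _ that(1)] W1_act[OF _ that(1)] that(3) by (metis Un_iff)
    thus ?thesis unfolding W by (auto simp: wall2_eq_iff[OF m0])
  qed
  have sign: "L a c r \<noteq> 0" "0 < L a c r \<longleftrightarrow> a \<le> 0 \<and> c \<le> 0" "a * c \<ge> 0" if "Q a c r s" for a c r s
  proof -
    have Q: "odd r" "int m dvd r - 1" "r\<^sup>2 + int m * s\<^sup>2 = 4 * int m * (a * c) + 1"
      using that by (simp_all add: Q_def)
    show "L a c r \<noteq> 0" "0 < L a c r \<longleftrightarrow> a \<le> 0 \<and> c \<le> 0" "a * c \<ge> 0"
      unfolding L_def by (rule wall2_sign[OF m \<nu> Q])+
  qed
  have sign': "L a c r * L a' c' r' < 0 \<longleftrightarrow> (a \<le> 0 \<and> c \<le> 0) \<noteq> (a' \<le> 0 \<and> c' \<le> 0)"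
    if "Q a c r s" "Q a' c' r' s'" for a c r s a' c' r' s'
  proof -
    have "x * y < 0 \<longleftrightarrow> (0 < x) \<noteq> (0 < y)" if "x \<noteq> 0" "y \<noteq> 0" for x y :: int
      using that by (auto simp: mult_less_0_iff linorder_neq_iff)
    from this[OF sign(1)[OF that(1)] sign(1)[OF that(2)]] show ?thesis
      unfolding sign(2)[OF that(1)] sign(2)[OF that(2)] .
  qed
  have val: "wval (wall2 m a c r s) g = sqrt m * of_int (L a' c' r')"
    if "herm_act (wall2 m a c r s) g = wall2 m a' c' r' s'" for g a c r s a' c' r' s'
    unfolding wval_def herm_act_mult that htrace_wall2[OF m] L_def \<nu>_def ..
  have val1: "wval (wall2 m a c r s) (mat 1) = sqrt m * of_int (L a c r)" for a c r s
    by (rule val) simp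
  have less0: "sqrt m * real_of_int x * (sqrt m * real_of_int y) < 0 \<longleftrightarrow> x * y < 0" for x y
    using m0 by (auto simp: mult_less_0_iff zero_less_mult_iff)
  have sep: "separating x y = {v. (\<exists>a c r s. v = wall2 m a c r s \<and> Q a c r s) \<and> wval v x * wval v y < 0}" for x y
    unfolding separating_def unfolding W by auto

  \<comment> \<open>\<open>h\<close> fixes the cusp 1 and moves the base point across a single wall, whereas the translation \<open>t\<close>
    crosses two walls of different colours; hence \<open>h\<inverse>\<close> and \<open>t h\<close> map to the free generators.\<close>
  let ?h = "level2_matrix m 0 1 0 (- 1) 0 1 0 (- 1)" and ?t = "level2_matrix m 0 0 (- 1) 2 0 0 0 0"
  have h: "?h \<in> Delta_matrices m" and t: "?t \<in> Delta_matrices m"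
    by (rule level2_in_Delta; simp add: algebra_simps)+
  \<comment> \<open>\<open>?h\<close> is the identity plus \<open>2 * quad_omega m\<close> times the
    nilpotent matrix with both rows (1, -1); \<open>?t\<close> is translation by
    \<open>2 * sqrt_neg m\<close>.\<close>
  have eh: "entries m ?h 2 1 (- 1) (- 1) 1 1 0 (- 1)" and et: "entries m ?t 1 0 0 2 0 0 1 0"
    using m m0 h t by (auto intro!: entriesI det_Delta simp: zq_def quad_omega_def field_simps)
  have J: "Q 0 0 1 0" "Q 0 1 1 0" "Q 0 2 1 0" by (simp_all add: Q_def)
  have J0: "wall2 m 0 0 1 0 \<in> walls2 m even" "wall2 m 0 2 1 0 \<in> walls2 m even"
    and J1: "wall2 m 0 1 1 0 \<in> walls2 m odd"
    unfolding walls2_def by force+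

  have act_h: "\<exists>a' c' r' s'. herm_act (wall2 m a c r s) ?h = wall2 m a' c' r' s' \<and>
      a' = a * (4 + int m) + c * (1 + int m) + r + s * (2 + int m) \<and> a' + c' + s' = a + c + s" for a c r s
    by (intro exI conjI, rule wall2_act[OF eh]) (simp_all add: algebra_simps)
  have "separating (mat 1) ?h = {wall2 m 0 0 1 0}"
  proof (intro equalityI subsetI)
    fix v assume "v \<in> separating (mat 1) ?h"
    then obtain a c r s where v: "v = wall2 m a c r s" and Q: "Q a c r s"
      and x: "wval v (mat 1) * wval v ?h < 0" unfolding sep by blast
    obtain a' c' r' s' where v': "herm_act v ?h = wall2 m a' c' r' s'"
      and *: "a' = a * (4 + int m) + c * (1 + int m) + r + s * (2 + int m)" "a' + c' + s' = a + c + s"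
      using act_h unfolding v by blast
    have Q': "Q a' c' r' s'" using Q_act[OF h Q] v' v by blast
    have "(a \<le> 0 \<and> c \<le> 0) \<noteq> (a' \<le> 0 \<and> c' \<le> 0)"
      using x unfolding v val1 val[OF v'[unfolded v]] less0 sign'[OF Q Q'] .
    hence "a = 0 \<and> c = 0 \<and> r = 1 \<and> s = 0"
      using wall2_cross_h[OF m, of r s a c a' r' s' c'] Q Q' * unfolding Q_def by blast
    thus "v \<in> {wall2 m 0 0 1 0}" using v by simp
  next
    fix v assume "v \<in> {wall2 m 0 0 1 0}"
    hence v: "v = wall2 m 0 0 1 0" by simp
    obtain a' c' r' s' where v': "herm_act v ?h = wall2 m a' c' r' s'" and "a' = 1"
      using act_h[of 0 0 1 0] unfolding v by auto
    have "wval v (mat 1) * wval v ?h < 0"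
      unfolding v val1 val[OF v'[unfolded v]] less0 sign'[OF J(1) Q_act[OF h J(1) v'[unfolded v]]]
      using \<open>a' = 1\<close> by simp
    thus "v \<in> separating (mat 1) ?h" unfolding sep using v J by blast
  qed
  \<comment> \<open>The wall is crossed from its positive to its negative side, so \<open>?h\<close>
    gives an inverse generator.\<close>
  moreover have "wval (wall2 m 0 0 1 0) ?h < 0"
  proof -
    obtain a' c' r' s' where v': "herm_act (wall2 m 0 0 1 0) ?h = wall2 m a' c' r' s'" and "a' = 1"
      using act_h[of 0 0 1 0] by auto
    have "L a' c' r' < 0"
      using sign(1,2)[OF Q_act[OF h J(1) v']] \<open>a' = 1\<close> by auto
    thus ?thesis unfolding val[OF v'] using m0 by (simp add: mult_pos_neg)
  qed
  ultimately have ch: "crossing ?h = [(0, False)]"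
    using crossing_single[of ?h] h J0 by (simp add: wcol_def)

  have act_t: "herm_act (wall2 m a c r s) ?t = wall2 m a (a * (4 * int m) + c - 2 * r) (r - 4 * a * int m) s" for a c r s
    unfolding wall2_act[OF et] by (simp add: algebra_simps)
  have valt: "wval (wall2 m 0 c 1 0) ?t = sqrt m * of_int (L 0 (c - 2) 1)" for c
    by (rule val[of _ _ _ _ _ _ _ _ 0]) (simp add: act_t)
  have "separating (mat 1) ?t = {wall2 m 0 1 1 0, wall2 m 0 2 1 0}"
  proof (intro equalityI subsetI)
    fix v assume "v \<in> separating (mat 1) ?t"
    then obtain a c r s where v: "v = wall2 m a c r s" and Q: "Q a c r s"
      and x: "wval v (mat 1) * wval v ?t < 0" unfolding sep by blast
    have Q': "Q a (a * (4 * int m) + c - 2 * r) (r - 4 * a * int m) s"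
      by (rule Q_act[OF t Q act_t])
    have "(a \<le> 0 \<and> c \<le> 0) \<noteq> (a \<le> 0 \<and> a * (4 * int m) + c - 2 * r \<le> 0)"
      using x unfolding v val1 val[OF act_t] less0 sign'[OF Q Q'] .
    with wall2_cross_t[OF m _ _ _ refl sign(3)[OF Q']] Q
    have "a = 0 \<and> (c = 1 \<or> c = 2) \<and> r = 1 \<and> s = 0" unfolding Q_def by blast
    thus "v \<in> {wall2 m 0 1 1 0, wall2 m 0 2 1 0}" using v by auto
  next
    fix v assume v: "v \<in> {wall2 m 0 1 1 0, wall2 m 0 2 1 0}"
    hence "wval v (mat 1) * wval v ?t < 0"
      by (auto simp only: val1 valt less0 insert_iff empty_iff) (simp_all add: L_def)
    thus "v \<in> separating (mat 1) ?t" unfolding sep using v J by blast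
  qed
  \<comment> \<open>The base values are \<open>- sqrt m\<close> and \<open>- 3 * sqrt m\<close>, so
    the wall with \<open>c = 1\<close> comes first.\<close>
  hence "wall_list (mat 1) (separating (mat 1) ?t) [wall2 m 0 1 1 0, wall2 m 0 2 1 0]"
    using m0 by (simp add: wall_list_def val1 L_def abs_mult)
  hence "walls_between (mat 1) ?t = [wall2 m 0 1 1 0, wall2 m 0 2 1 0]"
    using t subgroup.one_closed[OF subgroup_Delta_matrices[of m]] by (intro walls_between_eqI) simp_all
  moreover have "wcol (wall2 m 0 1 1 0) = 1" "wcol (wall2 m 0 2 1 0) = 0"
    using J0 J1 colours by (auto simp: wcol_def)
  moreover have "wval (wall2 m 0 1 1 0) ?t > 0" "wval (wall2 m 0 2 1 0) ?t > 0"
    unfolding valt using m0 by (simp_all add: L_def)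
  ultimately have ct: "crossing ?t = [(1, True), (0, True)]"
    by (simp add: crossing_def crossing_word_def reduce_def reduced_mult_def)

  interpret cr: group_hom "Delta_SL m" "free_group {0, 1}" crossing
    by (intro group_hom.intro group_hom_axioms.intro group_Delta_SL group_free_group crossing_hom)
  have h': "inv\<^bsub>Delta_SL m\<^esub> ?h \<in> Delta_matrices m" using inv_closed[of ?h] h by simp
  have "crossing (inv\<^bsub>Delta_SL m\<^esub> ?h) = inv\<^bsub>free_group {0, 1}\<^esub> [(0, False)]"
    using cr.hom_inv[of ?h] h ch by simp
  also have "\<dots> = [(0, True)]"
    by (rule cr.H.inv_equality) (auto simp: free_group_def reduced_mult_def)
  finally have "crossing (inv\<^bsub>Delta_SL m\<^esub> ?h) = [(0, True)]" .
  \<comment> \<open>The letter of \<open>?h\<close> cancels the last letter of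
    \<open>?t\<close>.\<close>
  moreover have "crossing (?t ** ?h) = [(1, True)]"
    using cr.hom_mult[of ?t ?h] t h ct ch by (simp add: free_group_def reduced_mult_def)
  moreover have "?t ** ?h \<in> Delta_matrices m" using m_closed[of ?t ?h] t h by simp
  ultimately show ?thesis using h' by (intro retracts_onto_free) blast
qed

theorem proposition1p4:
  fixes m :: nat
  assumes "m > 0" and "squarefree m"
  shows "retracts_onto (Delta m) (free_group {0, 1 :: nat})"
  using Delta_retracts_3[of m] Delta_retracts_not_3[of m] assms(1) by blast

end
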